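(* For a locally convex linear metric space $X$ (a metrizable locally convex linear topological space over $\mathbb R$) the following conditions are equivalent: (1) $(X,w)$ is metrizable. (2) $(X,w)$ is Ascoli. (3) $(X,w)$ contains no strong $\mathrm{Fin}^\omega$-fan. (4) The weak topology on $X$ coincides with the original topology of $X$. (5) The dual space $X^*$ has at most countable Hamel basis.
   Context: $X^*$ is the linear space of all continuous linear functionals on $X$; $(X,w)$ is $X$ endowed with the weak topology, the smallest topology making all functionals in $X^*$ continuous. For a space $Y$, $C_k(Y)$ is the space of continuous real-valued functions on $Y$ with the compact-open topology. A Tychonoff space $Y$ is Ascoli if for each compact $K\subset C_k(Y)$ the evaluation map $K\times Y\to\mathbb R$, $(f,y)\mapsto f(y)$, is continuous. A family $(F_n)_{n\in\omega}$ of subsets of $Y$ is locally finite if each point of $Y$ has a neighborhood meeting $F_n$ for only finitely many $n$; it is compact-finite if each compact subset of $Y$ meets $F_n$ for only finitely many $n$. A set $U\subset Y$ is $\mathbb R$-open if for each $y\in U$ there is a continuous $f:Y\to[0,1]$ with $f(y)=1$ and $f(Y\setminus U)\subset\{0\}$. A $\mathrm{Fin}^\omega$-fan in $Y$ is a family $(F_n)_{n\in\omega}$ of finite subsets of $Y$ that is compact-finite but not locally finite; it is strong if each $F_n$ has an $\mathbb R$-open neighborhood $U_n\supset F_n$ such that $(U_n)_{n\in\omega}$ is compact-finite. *)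

theory Defs
  imports "HOL-Analysis.Analysis" "HOL-Library.Function_Algebras"
begin

section \<open>Pointwise vector space structure on functions\<close>

text \<open>Makes \<open>span\<close> and \<open>independent\<close> available for sets of functionals.\<close>

instantiation "fun" :: (type, real_vector) real_vector
begin

definition scaleR_fun :: "real \<Rightarrow> ('a \<Rightarrow> 'b) \<Rightarrow> 'a \<Rightarrow> 'b"
  where "scaleR_fun c f = (\<lambda>x. c *\<^sub>R f x)"

instance
  by standard (simp_all add: scaleR_fun_def fun_eq_iff algebra_simps)

end

section \<open>Topological vector spaces with an explicit topology\<close>

text \<open>
  The topology is a term rather than a type class instance, because the original and
  the weak topology live on the same vector space.
\<close>

definition linear_topology :: "'a::real_vector topology \<Rightarrow> bool"
  where "linear_topology T \<longleftrightarrow>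
    topspace T = UNIV \<and>
    continuous_map (prod_topology T T) T (\<lambda>(x, y). x + y) \<and>
    continuous_map (prod_topology euclideanreal T) T (\<lambda>(c, x). c *\<^sub>R x)"

definition locally_convex_linear_metric :: "'a::real_vector topology \<Rightarrow> bool"
  where "locally_convex_linear_metric T \<longleftrightarrow>
    linear_topology T \<and> neighbourhood_base_of convex T \<and> metrizable_space T"

definition dual_space :: "'a::real_vector topology \<Rightarrow> ('a \<Rightarrow> real) set"
  where "dual_space T = {f. linear f \<and> continuous_map T euclideanreal f}"

definition weak_topology :: "'a::real_vector topology \<Rightarrow> 'a topology"
  where "weak_topology T =
    topology_generated_by {f -` V | f V. f \<in> dual_space T \<and> open V}"

definition hamel_basis :: "'v::real_vector set \<Rightarrow> 'v set \<Rightarrow> bool"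
  where "hamel_basis V B \<longleftrightarrow> B \<subseteq> V \<and> independent B \<and> span B = V"

section \<open>Ascoli spaces\<close>

text \<open>
  Functions on \<open>topspace Y\<close> are represented by their extensional extensions, so that
  functions agreeing on \<open>topspace Y\<close> are identified.
\<close>

definition continuous_functions :: "'a topology \<Rightarrow> ('a \<Rightarrow> real) set"
  where "continuous_functions Y =
    {f \<in> extensional (topspace Y). continuous_map Y euclideanreal f}"

definition compact_open_topology :: "'a topology \<Rightarrow> ('a \<Rightarrow> real) topology"
  where "compact_open_topology Y =
    topology_generated_by
      {{f \<in> continuous_functions Y. f ` K \<subseteq> V} | K V. compactin Y K \<and> open V}"

definition Tychonoff_space :: "'a topology \<Rightarrow> bool"
  where "Tychonoff_space Y \<longleftrightarrow> completely_regular_space Y \<and> Hausdorff_space Y"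

definition Ascoli_space :: "'a topology \<Rightarrow> bool"
  where "Ascoli_space Y \<longleftrightarrow>
    Tychonoff_space Y \<and>
    (\<forall>K. compactin (compact_open_topology Y) K \<longrightarrow>
      continuous_map (prod_topology (subtopology (compact_open_topology Y) K) Y)
        euclideanreal (\<lambda>(f, y). f y))"

section \<open>Fans\<close>

text \<open>
  Both notions concern indexed families: they count indices, not distinct members,
  unlike \<^const>\<open>locally_finite_in\<close>.
\<close>

definition locally_finite_family :: "'a topology \<Rightarrow> (nat \<Rightarrow> 'a set) \<Rightarrow> bool"
  where "locally_finite_family Y F \<longleftrightarrow>
    (\<forall>y \<in> topspace Y. \<exists>U. openin Y U \<and> y \<in> U \<and> finite {n. U \<inter> F n \<noteq> {}})"

definition compact_finite_family :: "'a topology \<Rightarrow> (nat \<Rightarrow> 'a set) \<Rightarrow> bool"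
  where "compact_finite_family Y F \<longleftrightarrow>
    (\<forall>K. compactin Y K \<longrightarrow> finite {n. K \<inter> F n \<noteq> {}})"

definition R_open :: "'a topology \<Rightarrow> 'a set \<Rightarrow> bool"
  where "R_open Y U \<longleftrightarrow>
    U \<subseteq> topspace Y \<and>
    (\<forall>y \<in> U. \<exists>f. continuous_map Y (top_of_set {0..1::real}) f \<and>
      f y = 1 \<and> f ` (topspace Y - U) \<subseteq> {0})"

definition Fin_fan :: "'a topology \<Rightarrow> (nat \<Rightarrow> 'a set) \<Rightarrow> bool"
  where "Fin_fan Y F \<longleftrightarrow>
    (\<forall>n. finite (F n) \<and> F n \<subseteq> topspace Y) \<and>
    compact_finite_family Y F \<and> \<not> locally_finite_family Y F"

definition strong_Fin_fan :: "'a topology \<Rightarrow> (nat \<Rightarrow> 'a set) \<Rightarrow> bool"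
  where "strong_Fin_fan Y F \<longleftrightarrow>
    Fin_fan Y F \<and>
    (\<exists>U. (\<forall>n. R_open Y (U n) \<and> F n \<subseteq> U n) \<and> compact_finite_family Y U)"

section \<open>Basic properties\<close>

lemma topspace_weak_topology [simp]: "topspace (weak_topology T) = UNIV"
proof -
  have "(\<lambda>_. 0) \<in> dual_space T"
    by (simp add: dual_space_def linear_iff)
  then have "UNIV \<in> {f -` V | f V. f \<in> dual_space T \<and> open V}"
    using open_UNIV by blast
  then show ?thesis
    unfolding weak_topology_def topology_generated_by_topspace by blast
qed

lemma weak_topology_coarsest:
  assumes "topspace S = UNIV"
  shows "(\<forall>f \<in> dual_space T. continuous_map S euclideanreal f) \<longleftrightarrow>
    (\<forall>U. openin (weak_topology T) U \<longrightarrow> openin S U)"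
proof
  assume *: "\<forall>f \<in> dual_space T. continuous_map S euclideanreal f"
  have "openin S (f -` V)" if "f \<in> dual_space T" "open V" for f V
    using openin_continuous_map_preimage[of S euclideanreal f V] * that assms
    by (simp add: vimage_def)
  then have gen: "openin S W" if "W \<in> {f -` V | f V. f \<in> dual_space T \<and> open V}" for W
    using that by blast
  have "openin S U"
    if "generate_topology_on {f -` V | f V. f \<in> dual_space T \<and> open V} U" for U
    using that by induction (auto intro: gen)
  then show "\<forall>U. openin (weak_topology T) U \<longrightarrow> openin S U"
    unfolding weak_topology_def openin_topology_generated_by_iff by blast
next
  assume "\<forall>U. openin (weak_topology T) U \<longrightarrow> openin S U"
  moreover have "openin (weak_topology T) (f -` V)" if "f \<in> dual_space T" "open V" for f V
    unfolding weak_topology_def using that by (intro topology_generated_by_Basis) blast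
  ultimately show "\<forall>f \<in> dual_space T. continuous_map S euclideanreal f"
    using assms by (auto simp: continuous_map_def vimage_def)
qed

lemma topspace_compact_open_topology [simp]:
  "topspace (compact_open_topology Y) = continuous_functions Y"
proof -
  have "continuous_functions Y \<in>
      {{f \<in> continuous_functions Y. f ` K \<subseteq> V} | K V. compactin Y K \<and> open V}"
    by (rule CollectI, intro exI[of _ "{}"] exI[of _ UNIV]) auto
  then show ?thesis
    unfolding compact_open_topology_def topology_generated_by_topspace by blast
qed

end

theory Submission
  imports Defs
begin

text \<open>
  The polar of a neighbourhood of \<open>0\<close> is a convex compact set in the topology of pointwise
  convergence, and \<open>X\<^sup>*\<close> is the increasing union of the polars \<open>P\<^sub>n\<close> of a countable neighbourhood
  base. Going round (4), (1), (2), (3), (5), (4), only the last two steps need more than general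
  topology.

  (3) implies (5): if no countable Hamel basis exists, some polar \<open>P\<close> is infinite-dimensional. The
  sets \<open>{x. \<exists>f\<in>P. \<bar>f x\<bar> > n}\<close> are then compact-finite, as \<open>P\<close> is uniformly bounded on weakly compact
  sets by the Baire category theorem in \<open>P\<close>. For all \<open>f\<^sub>1, ..., f\<^sub>n \<in> P\<^sub>n\<close> the \<open>n\<close>-th set
  contains a common zero of the \<open>f\<^sub>i\<close>; compactness of \<open>P\<^sub>n\<close> to the power \<open>n\<close> yields a finite
  subset that contains, for all such tuples at once, a point where all \<open>\<bar>f\<^sub>i\<bar> < 1\<close>. These finite sets
  accumulate at \<open>0\<close> weakly.

  (5) implies (4): if \<open>X\<^sup>*\<close> has a countable Hamel basis, then the Baire category theorem puts every
  polar into a finite-dimensional space, and by the Hahn--Banach theorem each neighbourhood of \<open>0\<close>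
  contains the common kernel of finitely many continuous functionals.
\<close>

section \<open>The Hahn--Banach theorem\<close>

text \<open>
  A minimal sublinear functional is linear, so Zorn's lemma on the sublinear functionals below \<open>p\<close>
  produces linear ones. Tilting \<open>p\<close> in the direction \<open>z\<close> serves twice: to prove that minimal elements
  are odd, and to force equality with \<open>p\<close> at a given point.
\<close>

definition sublinear :: "('a::real_vector \<Rightarrow> real) \<Rightarrow> bool"
  where "sublinear p \<longleftrightarrow>
    (\<forall>x y. p (x + y) \<le> p x + p y) \<and> (\<forall>c x. 0 \<le> c \<longrightarrow> p (c *\<^sub>R x) = c * p x)"

text \<open>One-sided homogeneity suffices: applied to \<open>inverse c\<close> it yields the
  reverse inequality.\<close>

lemma sublinearI:
  assumes "\<And>x y. p (x + y) \<le> p x + p y"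
    and "p 0 = 0" and "\<And>c x. 0 < c \<Longrightarrow> p (c *\<^sub>R x) \<le> c * p x"
  shows "sublinear p"
proof -
  have "p (c *\<^sub>R x) = c * p x" if "0 \<le> c" for c x
  proof (cases "c = 0")
    case False
    with that have "0 < c" by simp
    then have "p (inverse c *\<^sub>R c *\<^sub>R x) \<le> inverse c * p (c *\<^sub>R x)"
      by (intro assms(3)) simp
    with \<open>0 < c\<close> have "c * p x \<le> p (c *\<^sub>R x)"
      by (simp add: field_simps)
    with assms(3)[OF \<open>0 < c\<close>, of x] show ?thesis by simp
  qed (simp add: assms(2))
  with assms(1) show ?thesis by (simp add: sublinear_def)
qed

lemma
  assumes "sublinear p"
  shows sublinear_add: "p (x + y) \<le> p x + p y"
    and sublinear_scaleR: "0 \<le> c \<Longrightarrow> p (c *\<^sub>R x) = c * p x"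
    and sublinear_zero: "p 0 = 0"
    and sublinear_minus: "- p (- x) \<le> p x"
proof -
  show 1: "p (x + y) \<le> p x + p y" for x y
    using assms by (simp add: sublinear_def)
  show 2: "p (c *\<^sub>R x) = c * p x" if "0 \<le> c" for c x
    using assms that by (simp add: sublinear_def)
  show "p 0 = 0" using 2[of 0 0] by simp
  then show "- p (- x) \<le> p x" using 1[of x "- x"] by simp
qed

text \<open>The witness is the infimum over \<open>t \<ge> 0\<close> of
  \<open>p (x + t *\<^sub>R z) - t * p z\<close>. Taking \<open>t = 0\<close> gives
  \<open>q \<le> p\<close>, taking \<open>t = 1\<close> at \<open>- z\<close> gives the last
  inequality, and subadditivity of \<open>p\<close> bounds the infimum below by
  \<open>- p (- x)\<close>.\<close>

lemma sublinear_tilt: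
  assumes p: "sublinear p"
  obtains q where "sublinear q" "q \<le> p" "q (- z) \<le> - p z"
proof
  define S where "S x = {p (x + t *\<^sub>R z) - t * p z | t. 0 \<le> t}" for x
  define q where "q x = Inf (S x)" for x
  have bdd: "bdd_below (S x)" for x
  proof (rule bdd_belowI)
    fix a assume "a \<in> S x"
    then obtain t where t: "0 \<le> t" "a = p (x + t *\<^sub>R z) - t * p z"
      unfolding S_def by auto
    have "t * p z = p (t *\<^sub>R z)" using sublinear_scaleR[OF p] t by simp
    also have "\<dots> \<le> p (x + t *\<^sub>R z) + p (- x)"
      using sublinear_add[OF p, of "x + t *\<^sub>R z" "- x"] by simp
    finally show "- p (- x) \<le> a" using t by simp
  qed
  have le: "q x \<le> p (x + t *\<^sub>R z) - t * p z" if "0 \<le> t" for x t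
    unfolding q_def by (rule cInf_lower[OF _ bdd]) (use that S_def in auto)
  have ge: "a \<le> q x" if "\<And>t. 0 \<le> t \<Longrightarrow> a \<le> p (x + t *\<^sub>R z) - t * p z" for a x
    unfolding q_def by (rule cInf_greatest) (use that S_def in \<open>auto intro: exI[of _ 0]\<close>)
  show "q \<le> p" using le[of 0] by (simp add: le_fun_def)
  show "q (- z) \<le> - p z" using le[of 1 "- z"] sublinear_zero[OF p] by simp
  show "sublinear q"
  proof (rule sublinearI)
    fix x y
    \<comment> \<open>Parameters \<open>t\<close> for \<open>x\<close> and \<open>s\<close> for
      \<open>y\<close> add up to a parameter for \<open>x + y\<close>; the two infima are then taken
      one after the other.\<close>
    have "q (x + y) - (p (y + s *\<^sub>R z) - s * p z) \<le> p (x + t *\<^sub>R z) - t * p z"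
      if "0 \<le> s" "0 \<le> t" for s t
      using le[of "t + s" "x + y"] that sublinear_add[OF p, of "x + t *\<^sub>R z" "y + s *\<^sub>R z"]
      by (simp add: algebra_simps)
    then have "q (x + y) - (p (y + s *\<^sub>R z) - s * p z) \<le> q x" if "0 \<le> s" for s
      using ge that by blast
    then have "q (x + y) - q x \<le> p (y + s *\<^sub>R z) - s * p z" if "0 \<le> s" for s
      using that by (simp add: algebra_simps)
    then have "q (x + y) - q x \<le> q y" using ge by blast
    then show "q (x + y) \<le> q x + q y" by simp
  next
    show "q 0 = 0"
      using le[of 0 0] ge[of 0 0] sublinear_zero[OF p] sublinear_scaleR[OF p]
      by (intro antisym) auto
  next
    fix c :: real and x assume c: "0 < c"
    have "inverse c * q (c *\<^sub>R x) \<le> p (x + t *\<^sub>R z) - t * p z" if "0 \<le> t" for t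
    proof -
      have "q (c *\<^sub>R x) \<le> p (c *\<^sub>R x + (c * t) *\<^sub>R z) - c * t * p z"
        using le[of "c * t" "c *\<^sub>R x"] that c by simp
      also have "p (c *\<^sub>R x + (c * t) *\<^sub>R z) = c * p (x + t *\<^sub>R z)"
        using sublinear_scaleR[OF p, of c "x + t *\<^sub>R z"] c by (simp add: scaleR_add_right)
      finally show ?thesis using c by (simp add: field_simps)
    qed
    then have "inverse c * q (c *\<^sub>R x) \<le> q x" by (rule ge)
    then show "q (c *\<^sub>R x) \<le> c * q x" using c by (simp add: field_simps)
  qed
qed

text \<open>A tilt of \<open>q\<close> lies below \<open>q\<close>, so by minimality it is
  \<open>q\<close> itself, and hence \<open>q (- z) \<le> - q z\<close>. An odd sublinear functional
  is linear.\<close>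

lemma minimal_sublinear_linear:
  assumes q: "sublinear q" and min: "\<And>r. sublinear r \<Longrightarrow> r \<le> q \<Longrightarrow> r = q"
  shows "linear q"
proof -
  have minus: "q (- z) = - q z" for z
  proof -
    obtain r where "sublinear r" "r \<le> q" "r (- z) \<le> - q z"
      using sublinear_tilt[OF q] .
    with min have "q (- z) \<le> - q z" by metis
    with sublinear_minus[OF q, of z] show ?thesis by simp
  qed
  show ?thesis
  proof (rule linearI)
    fix x y
    show "q (x + y) = q x + q y"
      using sublinear_add[OF q, of x y] sublinear_add[OF q, of "x + y" "- y"] minus[of y] by simp
  next
    fix c x
    show "q (c *\<^sub>R x) = c *\<^sub>R q x"
      using sublinear_scaleR[OF q, of c x] sublinear_scaleR[OF q, of "- c" x] minus[of "c *\<^sub>R x"]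
      by (cases "0 \<le> c") auto
  qed
qed

text \<open>The pointwise infimum works; it is finite because \<open>- p (- x) \<le> q x\<close>. It
  is subadditive because any two members of a chain lie above a common member, namely the smaller
  one.\<close>

lemma chain_Inf_sublinear:
  assumes ne: "C \<noteq> {}" and sub: "\<And>q. q \<in> C \<Longrightarrow> sublinear q"
    and lb: "\<And>q. q \<in> C \<Longrightarrow> q \<le> p" and tot: "\<And>q r. q \<in> C \<Longrightarrow> r \<in> C \<Longrightarrow> q \<le> r \<or> r \<le> q"
  obtains m where "sublinear m" "\<And>q. q \<in> C \<Longrightarrow> m \<le> q"
proof
  define m where "m x = Inf ((\<lambda>q. q x) ` C)" for x
  have bdd: "bdd_below ((\<lambda>q. q x) ` C)" for x
  proof (rule bdd_belowI2)
    fix q assume q: "q \<in> C"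
    show "- p (- x) \<le> q x"
      using sublinear_minus[OF sub[OF q], of x] le_funD[OF lb[OF q], of "- x"] by linarith
  qed
  have le: "m x \<le> q x" if "q \<in> C" for q x
    unfolding m_def by (rule cInf_lower[OF _ bdd]) (use that in auto)
  then show "m \<le> q" if "q \<in> C" for q using that by (simp add: le_fun_def)
  have ge: "a \<le> m x" if "\<And>q. q \<in> C \<Longrightarrow> a \<le> q x" for a x
    unfolding m_def by (rule cInf_greatest) (use that ne in auto)
  show "sublinear m"
  proof (rule sublinearI)
    fix x y
    have "m (x + y) - r y \<le> q x" if qr: "q \<in> C" "r \<in> C" for q r
    proof -
      obtain s where s: "s \<in> C" "s \<le> q" "s \<le> r"
        using tot[OF qr] qr by (metis order_refl)
      have "m (x + y) \<le> s x + s y"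
        using le[OF s(1), of "x + y"] sublinear_add[OF sub[OF s(1)], of x y] by linarith
      then show ?thesis using le_funD[OF s(2), of x] le_funD[OF s(3), of y] by linarith
    qed
    then have *: "m (x + y) - r y \<le> m x" if "r \<in> C" for r
      using ge that by blast
    have "m (x + y) - m x \<le> r y" if "r \<in> C" for r
      using *[OF that] by linarith
    then have "m (x + y) - m x \<le> m y" using ge by blast
    then show "m (x + y) \<le> m x + m y" by simp
  next
    obtain q where q: "q \<in> C" using ne by blast
    have "m 0 \<le> 0" using le[OF q, of 0] sublinear_zero[OF sub[OF q]] by simp
    moreover have "0 \<le> m 0" by (rule ge) (simp add: sublinear_zero[OF sub])
    ultimately show "m 0 = 0" by simp
  next
    fix c :: real and x assume c: "0 < c"
    have "inverse c * m (c *\<^sub>R x) \<le> q x" if "q \<in> C" for q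
      using le[OF that, of "c *\<^sub>R x"] sublinear_scaleR[OF sub[OF that], of c x] c
      by (simp add: field_simps)
    then have "inverse c * m (c *\<^sub>R x) \<le> m x" by (rule ge)
    then show "m (c *\<^sub>R x) \<le> c * m x" using c by (simp add: field_simps)
  qed
qed

theorem Hahn_Banach_sublinear:
  assumes p: "sublinear p"
  obtains f where "linear f" "f \<le> p" "f x = p x"
proof -
  \<comment> \<open>Any linear \<open>f \<le> p'\<close> satisfies
    \<open>- f x = f (- x) \<le> - p x\<close>, so tilting first settles the equality at
    \<open>x\<close>.\<close>
  obtain p' where p': "sublinear p'" "p' \<le> p" "p' (- x) \<le> - p x"
    using sublinear_tilt[OF p] .
  define A where "A = {q. sublinear q \<and> q \<le> p'}"
  \<comment> \<open>Zorn's lemma is applied to the reversed order, with \<open>p'\<close> bounding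
    the empty chain.\<close>
  have "\<exists>m\<in>A. \<forall>a\<in>A. a \<le> m \<longrightarrow> a = m"
  proof (rule predicate_Zorn)
    show "partial_order_on A (relation_of (\<lambda>a b. b \<le> a) A)"
      by (rule partial_order_on_relation_ofI) auto
  next
    fix C assume "C \<in> Chains (relation_of (\<lambda>a b. b \<le> a) A)"
    then have C: "q \<in> A" "q \<le> r \<or> r \<le> q" if "q \<in> C" "r \<in> C" for q r
      using that by (auto simp: Chains_def relation_of_def)
    show "\<exists>u\<in>A. \<forall>a\<in>C. u \<le> a"
    proof (cases "C = {}")
      case True
      then show ?thesis using p'(1) by (auto simp: A_def)
    next
      case False
      obtain m where m: "sublinear m" "\<And>q. q \<in> C \<Longrightarrow> m \<le> q"
        by (rule chain_Inf_sublinear[of C p']) (use C False in \<open>auto simp: A_def\<close>)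
      moreover obtain q where "q \<in> C" using False by blast
      ultimately have "m \<le> p'" using C(1)[of q q] by (auto simp: A_def intro: order_trans)
      with m show ?thesis by (auto simp: A_def)
    qed
  qed
  then obtain f where f: "sublinear f" "f \<le> p'" "\<And>a. a \<in> A \<Longrightarrow> a \<le> f \<Longrightarrow> a = f"
    by (auto simp: A_def)
  have "linear f"
    by (rule minimal_sublinear_linear[OF f(1)]) (use f in \<open>auto simp: A_def intro: order_trans\<close>)
  moreover have "f \<le> p" using f(2) p'(2) by (rule order_trans)
  moreover have "f x = p x"
    using le_funD[OF f(2), of "- x"] p'(3) le_funD[OF \<open>f \<le> p\<close>, of x] linear_neg[OF \<open>linear f\<close>, of x]
    by simp
  ultimately show thesis by (rule that)
qed

text \<open>The Minkowski gauge \<open>p\<close> of \<open>V\<close> is sublinear, at most 1 on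
  \<open>V\<close> and at least 1 at \<open>z\<close>, so a linear minorant agreeing with
  \<open>p\<close> at \<open>z\<close> has the required bounds. No topology enters here; in the
  application, continuity of \<open>f\<close> comes from membership in a polar.\<close>

lemma convex_absorbing_Hahn_Banach:
  fixes V :: "'a::real_vector set"
  assumes V: "convex V" and abs: "\<And>x. \<exists>t>0. t *\<^sub>R x \<in> V" and z: "z \<notin> V"
  obtains f :: "'a \<Rightarrow> real" where "linear f" "\<And>x. x \<in> V \<Longrightarrow> f x \<le> 1" "1 \<le> f z"
proof -
  define S where "S x = {t. 0 < t \<and> inverse t *\<^sub>R x \<in> V}" for x
  define p where "p x = Inf (S x)" for x
  have ne: "S x \<noteq> {}" for x
  proof -
    obtain t where "t > 0" "t *\<^sub>R x \<in> V" using abs by blast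
    then have "inverse t \<in> S x" by (simp add: S_def)
    then show ?thesis by blast
  qed
  have bdd: "bdd_below (S x)" for x by (rule bdd_belowI[of _ 0]) (auto simp: S_def)
  have le: "p x \<le> t" if "t \<in> S x" for t x
    unfolding p_def by (rule cInf_lower[OF that bdd])
  have ge: "a \<le> p x" if "\<And>t. t \<in> S x \<Longrightarrow> a \<le> t" for a x
    unfolding p_def by (rule cInf_greatest[OF ne]) (use that in auto)
  have add: "s + t \<in> S (x + y)" if "s \<in> S x" "t \<in> S y" for s t x y
  proof -
    from that have st: "0 < s" "0 < t" "inverse s *\<^sub>R x \<in> V" "inverse t *\<^sub>R y \<in> V"
      by (auto simp: S_def)
    \<comment> \<open>The convex weights are chosen so that the combination is \<open>x + y\<close>
      divided by \<open>s + t\<close>.\<close>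
    have "(s / (s + t)) *\<^sub>R (inverse s *\<^sub>R x) + (t / (s + t)) *\<^sub>R (inverse t *\<^sub>R y) \<in> V"
      using st by (intro convexD[OF V st(3,4)]) (auto simp: add_divide_distrib[symmetric])
    also have "(s / (s + t)) *\<^sub>R (inverse s *\<^sub>R x) + (t / (s + t)) *\<^sub>R (inverse t *\<^sub>R y)
        = inverse (s + t) *\<^sub>R (x + y)"
    proof -
      have "s / (s + t) * inverse s = inverse (s + t)" "t / (s + t) * inverse t = inverse (s + t)"
        using st by (simp_all add: divide_inverse)
      then show ?thesis by (simp only: scaleR_scaleR scaleR_add_right)
    qed
    finally show ?thesis using st by (simp add: S_def)
  qed
  have zero: "0 \<in> V" using abs[of 0] by simp
  have "sublinear p"
  proof (rule sublinearI)
    fix x y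
    have "p (x + y) - t \<le> s" if "s \<in> S x" "t \<in> S y" for s t
      using le[OF add[OF that]] by linarith
    then have "p (x + y) - t \<le> p x" if "t \<in> S y" for t
      using ge that by blast
    then have "p (x + y) - p x \<le> t" if "t \<in> S y" for t
      using that by (simp add: algebra_simps)
    then have "p (x + y) - p x \<le> p y" using ge by blast
    then show "p (x + y) \<le> p x + p y" by simp
  next
    have "p 0 \<le> e" if "0 < e" for e :: real
      by (rule le) (use that zero S_def in auto)
    moreover have "0 \<le> p 0" by (rule ge) (auto simp: S_def)
    ultimately show "p 0 = 0" by (meson dense_ge antisym)
  next
    fix c :: real and x assume c: "0 < c"
    have "inverse c * p (c *\<^sub>R x) \<le> t" if "t \<in> S x" for t
      using le[of "c * t" "c *\<^sub>R x"] that c by (simp add: S_def field_simps)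
    then have "inverse c * p (c *\<^sub>R x) \<le> p x" by (rule ge)
    then show "p (c *\<^sub>R x) \<le> c * p x" using c by (simp add: field_simps)
  qed
  moreover have "1 \<le> p z"
  proof (rule ge, rule ccontr)
    \<comment> \<open>For \<open>t < 1\<close> the point \<open>z\<close> would be a convex
      combination of \<open>inverse t *\<^sub>R z\<close> and 0, both in \<open>V\<close>.\<close>
    fix t assume t: "t \<in> S z" "\<not> 1 \<le> t"
    then have "t *\<^sub>R (inverse t *\<^sub>R z) + (1 - t) *\<^sub>R 0 \<in> V"
      by (intro convexD[OF V _ zero]) (auto simp: S_def)
    with t z show False by (simp add: S_def)
  qed
  moreover have "p x \<le> 1" if "x \<in> V" for x
    using that by (intro le) (simp add: S_def)
  ultimately show thesis
    using that Hahn_Banach_sublinear[of p z] by (metis le_funD order_trans)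
qed

section \<open>A Baire category argument for pointwise compact sets\<close>

text \<open>By the Baire category theorem in the compact Hausdorff space \<open>A\<close>, some
  \<open>C n\<close> contains a relatively open set around a point \<open>g\<close>. Shrinking
  \<open>A\<close> towards \<open>g\<close> stays in \<open>A\<close> by convexity, and for a small
  factor \<open>t\<close> it enters that open set, since a basic neighbourhood restricts only
  finitely many coordinates and each coordinate is bounded on \<open>A\<close>.\<close>

lemma compact_convex_Baire:
  fixes A :: "('a \<Rightarrow> real) set"
  assumes A: "compact A" "A \<noteq> {}" and bound: "\<And>f x. f \<in> A \<Longrightarrow> \<bar>f x\<bar> \<le> r x"
    and conv: "convex A"
    and closed: "\<And>n::nat. closed (C n)" and cover: "A \<subseteq> (\<Union>n. C n)"
  obtains n g t where "g \<in> A \<inter> C n" "0 < t" "\<And>f. f \<in> A \<Longrightarrow> (1 - t) *\<^sub>R g + t *\<^sub>R f \<in> C n"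
proof -
  let ?X = "top_of_set A"
  have cl: "closedin ?X (A \<inter> C n)" for n
    using closed by (simp add: closedin_closed_Int)
  have "compact_space ?X" using A(1) by (simp add: compact_space_subtopology)
  moreover have "Hausdorff_space ?X"
    by (intro Hausdorff_space_subtopology)
      (metis Hausdorff_space_euclidean Hausdorff_space_product_topology euclidean_product_topology)
  ultimately have X: "locally_compact_space ?X \<and> regular_space ?X"
    by (simp add: compact_Hausdorff_imp_regular_space compact_imp_locally_compact_space)
  have "\<exists>n. ?X interior_of (A \<inter> C n) \<noteq> {}"
  proof (rule ccontr)
    assume "\<nexists>n. ?X interior_of (A \<inter> C n) \<noteq> {}"
    then have "?X interior_of \<Union> (range (\<lambda>n. A \<inter> C n)) = {}"
      by (intro Baire_category_alt) (use X cl in auto)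
    moreover have "\<Union> (range (\<lambda>n. A \<inter> C n)) = A" using cover by auto
    ultimately show False
      using A(2) interior_of_topspace[of ?X] by simp
  qed
  then obtain n g where g: "g \<in> ?X interior_of (A \<inter> C n)" by blast
  then obtain W where W: "openin ?X W" "g \<in> W" "W \<subseteq> A \<inter> C n"
    by (auto simp: interior_of_def)
  then obtain G where G: "open G" "W = A \<inter> G" by (auto simp: openin_open)
  then have "openin (product_topology (\<lambda>_. euclideanreal) UNIV) G" "g \<in> G"
    using W by (auto simp: euclidean_product_topology)
  from product_topology_open_contains_basis[OF this] obtain X where
    X: "g \<in> PiE UNIV X" "\<And>i. open (X i)" "finite {i. X i \<noteq> UNIV}" "PiE UNIV X \<subseteq> G"
    by auto
  \<comment> \<open>Coordinate \<open>i\<close> is moved by at most \<open>t * (2 * r i)\<close>,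
    uniformly in \<open>f\<close>.\<close>
  have "\<forall>\<^sub>F t in at_right 0. \<forall>f\<in>A. (1 - t) * g i + t * f i \<in> X i" for i
  proof -
    have "g i \<in> X i" using X(1) by auto
    then obtain e where e: "0 < e" "\<And>y. \<bar>y - g i\<bar> < e \<Longrightarrow> y \<in> X i"
      using X(2)[of i] by (auto simp: open_dist dist_real_def)
    have "((\<lambda>t. t * (2 * r i)) \<longlongrightarrow> 0 * (2 * r i)) (at_right 0)"
      by (intro tendsto_intros)
    then have "\<forall>\<^sub>F t in at_right 0. t * (2 * r i) < e"
      using e(1) by (auto dest: order_tendstoD(2))
    then show ?thesis using eventually_at_right_less[of 0]
    proof eventually_elim
      case (elim t)
      show ?case
      proof
        fix f assume f: "f \<in> A"
        have "\<bar>f i - g i\<bar> \<le> 2 * r i"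
          using bound[OF f, of i] bound[of g i] W by auto
        then have "t * \<bar>f i - g i\<bar> < e"
          using elim mult_left_mono[of "\<bar>f i - g i\<bar>" "2 * r i" t] by linarith
        then show "(1 - t) * g i + t * f i \<in> X i"
      proof (intro e(2))
          have "(1 - t) * g i + t * f i - g i = t * (f i - g i)" by (simp add: algebra_simps)
          then show "\<bar>(1 - t) * g i + t * f i - g i\<bar> < e"
            using elim \<open>t * \<bar>f i - g i\<bar> < e\<close> by (simp add: abs_mult)
        qed
      qed
    qed
  qed
  then have "\<forall>\<^sub>F t in at_right 0. \<forall>i\<in>{i. X i \<noteq> UNIV}. \<forall>f\<in>A. (1 - t) * g i + t * f i \<in> X i"
    by (intro eventually_ball_finite[OF X(3)] ballI)
  moreover have "\<forall>\<^sub>F t in at_right 0. t < (1::real)"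
    by (rule eventually_at_right_real[of 0 1, THEN eventually_mono]) auto
  moreover note eventually_at_right_less[of 0]
  ultimately have ev: "\<forall>\<^sub>F t in at_right 0. 0 < t \<and> t < 1 \<and>
      (\<forall>i\<in>{i. X i \<noteq> UNIV}. \<forall>f\<in>A. (1 - t) * g i + t * f i \<in> X i)"
    by eventually_elim auto
  then obtain t where t: "0 < t" "t < 1"
      "\<And>i f. X i \<noteq> UNIV \<Longrightarrow> f \<in> A \<Longrightarrow> (1 - t) * g i + t * f i \<in> X i"
    using eventually_happens'[OF trivial_limit_at_right_real ev] by auto
  show thesis
  proof (rule that)
    show "g \<in> A \<inter> C n" using W by auto
    show "0 < t" by fact
    fix f assume f: "f \<in> A"
    have "((1 - t) *\<^sub>R g + t *\<^sub>R f) i \<in> X i" for i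
      using t(3)[OF _ f, of i] by (cases "X i = UNIV") (auto simp: scaleR_fun_def)
    then have "(1 - t) *\<^sub>R g + t *\<^sub>R f \<in> G" using X(4) by auto
    moreover have "(1 - t) *\<^sub>R g + t *\<^sub>R f \<in> A"
      using W t f by (intro convexD[OF conv]) auto
    ultimately show "(1 - t) *\<^sub>R g + t *\<^sub>R f \<in> C n" using G W by auto
  qed
qed

section \<open>Polars and finitely many functionals\<close>

text \<open>The absolute polar, taken among all linear functionals so that it is closed under
  pointwise limits. For a neighbourhood of 0 its members are automatically continuous.\<close>

definition polar :: "'a::real_vector set \<Rightarrow> ('a \<Rightarrow> real) set"
  where "polar U = {f. linear f \<and> (\<forall>x\<in>U. \<bar>f x\<bar> \<le> 1)}"

lemma closed_linear_functionals: "closed {f :: 'a::real_vector \<Rightarrow> real. linear f}"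
proof -
  have "{f :: 'a \<Rightarrow> real. linear f} =
      (\<Inter>x y. {f. f (x + y) = f x + f y}) \<inter> (\<Inter>c x. {f. f (c *\<^sub>R x) = c * f x})"
    by (auto simp: linear_iff)
  also have "closed \<dots>"
    by (intro closed_Int closed_INT ballI closed_Collect_eq continuous_intros) auto
  finally show ?thesis .
qed

lemma closed_polar: "closed (polar U)"
proof -
  have "polar U = {f. linear f} \<inter> (\<Inter>x\<in>U. {f. \<bar>f x\<bar> \<le> 1})"
    by (auto simp: polar_def)
  also have "closed \<dots>"
    by (intro closed_Int closed_linear_functionals closed_INT ballI closed_Collect_le
        continuous_intros) auto
  finally show ?thesis .
qed

lemma polar_bounded:
  assumes "\<And>x. \<exists>t>0. t *\<^sub>R x \<in> U"
  obtains r where "\<And>f x. f \<in> polar U \<Longrightarrow> \<bar>f x\<bar> \<le> r x"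
proof -
  obtain t where t: "\<And>x. t x > 0" "\<And>x. t x *\<^sub>R x \<in> U" using assms by metis
  show thesis
  proof (rule that)
    fix f x assume f: "f \<in> polar U"
    then have "\<bar>f (t x *\<^sub>R x)\<bar> \<le> 1" using t(2) unfolding polar_def by blast
    then show "\<bar>f x\<bar> \<le> inverse (t x)"
      using f t(1)[of x] by (simp add: polar_def linear_cmul abs_mult field_simps)
  qed
qed

text \<open>Banach--Alaoglu: absorption confines the polar to a product of compact intervals, and it
  is closed in that product.\<close>

lemma compact_polar:
  assumes "\<And>x. \<exists>t>0. t *\<^sub>R x \<in> U"
  shows "compact (polar U)"
proof -
  obtain r where r: "\<And>f x. f \<in> polar U \<Longrightarrow> \<bar>f x\<bar> \<le> r x"
    using polar_bounded[OF assms] by metis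
  have "compactin (product_topology (\<lambda>_. euclideanreal) UNIV) (PiE UNIV (\<lambda>x. {- r x..r x}))"
    by (simp add: compactin_PiE)
  then have "compact (PiE UNIV (\<lambda>x. {- r x..r x}))"
    by (simp add: euclidean_product_topology)
  moreover have "polar U = PiE UNIV (\<lambda>x. {- r x..r x}) \<inter> polar U"
    using r by (force simp: abs_le_iff)
  ultimately show ?thesis using compact_Int_closed[OF _ closed_polar] by metis
qed

lemma convex_polar: "convex (polar U)"
proof (rule convexI)
  fix f g :: "'a \<Rightarrow> real" and u v :: real
  assume fg: "f \<in> polar U" "g \<in> polar U" and uv: "0 \<le> u" "0 \<le> v" "u + v = 1"
  have "linear (\<lambda>x. u *\<^sub>R f x + v *\<^sub>R g x)"
    using fg by (intro linear_compose_add linear_compose_scale_right) (auto simp: polar_def)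
  moreover have "\<bar>u * f x + v * g x\<bar> \<le> 1" if "x \<in> U" for x
  proof -
    have "\<bar>u * f x + v * g x\<bar> \<le> u * \<bar>f x\<bar> + v * \<bar>g x\<bar>"
      using uv by (metis abs_mult abs_of_nonneg abs_triangle_ineq)
    also have "\<dots> \<le> u * 1 + v * 1"
      using fg that uv by (intro add_mono mult_left_mono) (auto simp: polar_def)
    finally show ?thesis using uv by simp
  qed
  ultimately show "u *\<^sub>R f + v *\<^sub>R g \<in> polar U"
    by (simp add: polar_def scaleR_fun_def plus_fun_def)
qed

lemma zero_in_polar: "0 \<in> polar U"
  by (simp add: polar_def zero_fun_def linear_zero)

section \<open>Common kernels of finitely many functionals\<close>

lemma sum_fun_apply: "(\<Sum>i\<in>I. h i) x = (\<Sum>i\<in>I. h i x)"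
  for h :: "'i \<Rightarrow> 'a \<Rightarrow> 'b::comm_monoid_add"
  by (induction I rule: infinite_finite_induct) auto

text \<open>A Gram--Schmidt procedure: subtracting a finite-rank map with coefficients in
  \<open>span F\<close> moves every point into the common kernel of \<open>F\<close>. When
  \<open>g\<close> is added, either it already vanishes on all remainders, or one remainder supplies
  a new direction that corrects \<open>g\<close> without disturbing \<open>F\<close>.\<close>

lemma finite_functionals_decomposition:
  fixes F :: "('a::real_vector \<Rightarrow> real) set"
  assumes "finite F" "\<And>f. f \<in> F \<Longrightarrow> linear f"
  obtains m :: nat and e \<phi> where "\<And>i. i < m \<Longrightarrow> \<phi> i \<in> span F"
    "\<And>f x. f \<in> F \<Longrightarrow> f (x - (\<Sum>i<m. \<phi> i x *\<^sub>R e i)) = 0"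
proof -
  have "\<exists>(m::nat) e \<phi>. (\<forall>i<m. \<phi> i \<in> span F) \<and>
      (\<forall>f\<in>F. \<forall>x. f (x - (\<Sum>i<m. \<phi> i x *\<^sub>R e i)) = 0)"
    using assms
  proof (induction F rule: finite_induct)
    case empty
    show ?case by (intro exI[of _ 0]) auto
  next
    case (insert g F)
    then obtain m :: nat and e \<phi> where IH: "\<And>i. i < m \<Longrightarrow> \<phi> i \<in> span F"
      "\<And>f x. f \<in> F \<Longrightarrow> f (x - (\<Sum>i<m. \<phi> i x *\<^sub>R e i)) = 0"
      by (metis insertCI)
    have span: "\<phi> i \<in> span (insert g F)" if "i < m" for i
      using IH(1)[OF that] span_mono[of F "insert g F"] by blast
    have g: "linear g" using insert.prems by simp
    let ?R = "\<lambda>x. x - (\<Sum>i<m. \<phi> i x *\<^sub>R e i)"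
    show ?case
    proof (cases "\<forall>x. g (?R x) = 0")
      case True
      with IH(2) span show ?thesis by (intro exI[of _ m] exI[of _ e] exI[of _ \<phi>]) auto
    next
      case False
      then obtain y where y: "g (?R y) \<noteq> 0" by blast
      \<comment> \<open>The normalisation makes \<open>g d = 1\<close>; being a remainder,
        \<open>d\<close> is still killed by \<open>F\<close>.\<close>
      define d where "d = inverse (g (?R y)) *\<^sub>R ?R y"
      have d: "g d = 1" "\<And>f. f \<in> F \<Longrightarrow> f d = 0"
        using y g IH(2) insert.prems by (auto simp: d_def linear_cmul)
      \<comment> \<open>This is \<open>g\<close> composed with the remainder map, expanded so that
        membership in the span is visible.\<close>
      define \<psi> where "\<psi> = g - (\<Sum>i<m. g (e i) *\<^sub>R \<phi> i)"
      have \<psi>: "\<psi> x = g (?R x)" for x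
        by (simp add: \<psi>_def linear_diff[OF g] linear_sum[OF g] linear_cmul[OF g]
            scaleR_fun_def sum_fun_apply mult.commute)
      have "\<psi> \<in> span (insert g F)"
        unfolding \<psi>_def by (intro span_diff span_sum span_scale span span_base) auto
      moreover have "f (?R x - \<psi> x *\<^sub>R d) = 0" if "f \<in> insert g F" for f x
      proof -
        have f: "linear f" using insert.prems that by simp
        have "f (?R x - \<psi> x *\<^sub>R d) = f (?R x) - \<psi> x * f d"
          by (simp only: linear_diff[OF f] linear_cmul[OF f] real_scaleR_def)
        with that d IH(2)[of f x] \<psi>[of x] show ?thesis by auto
      qed
      moreover have "x - (\<Sum>i<Suc m. (\<phi>(m := \<psi>)) i x *\<^sub>R (e(m := d)) i) = ?R x - \<psi> x *\<^sub>R d" for x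
        by simp
      ultimately have "\<forall>f\<in>insert g F. \<forall>x.
          f (x - (\<Sum>i<Suc m. (\<phi>(m := \<psi>)) i x *\<^sub>R (e(m := d)) i)) = 0"
          "\<forall>i<Suc m. (\<phi>(m := \<psi>)) i \<in> span (insert g F)"
        using span by (simp_all only: less_Suc_eq) auto
      then show ?thesis by blast
    qed
  qed
  with that show thesis by blast
qed

text \<open>If \<open>g\<close> vanished on all remainders of the decomposition, it would equal the
  combination of the \<open>\<phi> i\<close> with coefficients \<open>g (e i)\<close> and so lie in
  \<open>span F\<close>.\<close>

lemma common_kernel_separates:
  fixes g :: "'a::real_vector \<Rightarrow> real"
  assumes F: "finite F" "\<And>f. f \<in> F \<Longrightarrow> linear f" and g: "linear g" "g \<notin> span F"
  obtains x where "\<And>f. f \<in> F \<Longrightarrow> f x = 0" "g x \<noteq> 0"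
proof -
  obtain m :: nat and e \<phi> where \<phi>: "\<And>i. i < m \<Longrightarrow> \<phi> i \<in> span F"
    "\<And>f x. f \<in> F \<Longrightarrow> f (x - (\<Sum>i<m. \<phi> i x *\<^sub>R e i)) = 0"
    using finite_functionals_decomposition[OF F] by metis
  have "\<exists>x. g (x - (\<Sum>i<m. \<phi> i x *\<^sub>R e i)) \<noteq> 0"
  proof (rule ccontr)
    assume "\<nexists>x. g (x - (\<Sum>i<m. \<phi> i x *\<^sub>R e i)) \<noteq> 0"
    then have vanish: "g (x - (\<Sum>i<m. \<phi> i x *\<^sub>R e i)) = 0" for x by blast
    have "g x = (\<Sum>i<m. g (e i) *\<^sub>R \<phi> i) x" for x
    proof -
      have "g x = g (\<Sum>i<m. \<phi> i x *\<^sub>R e i)"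
        using vanish[of x] by (simp only: linear_diff[OF g(1)])
      also have "\<dots> = (\<Sum>i<m. g (e i) *\<^sub>R \<phi> i) x"
        by (simp add: linear_sum[OF g(1)] linear_cmul[OF g(1)] scaleR_fun_def sum_fun_apply
            mult.commute)
      finally show ?thesis .
    qed
    then have "g = (\<Sum>i<m. g (e i) *\<^sub>R \<phi> i)" by blast
    also have "\<dots> \<in> span F" using \<phi>(1) by (intro span_sum span_scale) auto
    finally show False using g(2) by simp
  qed
  then obtain x where "g (x - (\<Sum>i<m. \<phi> i x *\<^sub>R e i)) \<noteq> 0" by blast
  with \<phi>(2) show thesis by (rule that)
qed

section \<open>Linear topologies and the weak topology\<close>

lemma linear_topology_absorbing:
  assumes T: "linear_topology T" and U: "openin T U" "0 \<in> U"
  shows "\<exists>t>0. t *\<^sub>R x \<in> U"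
proof -
  have "continuous_map euclideanreal (prod_topology euclideanreal T) (\<lambda>t. (t, x))"
    using T by (auto simp: linear_topology_def continuous_map_pairedI)
  from continuous_map_compose[OF this, of T "\<lambda>(c, x). c *\<^sub>R x"]
  have "continuous_map euclideanreal T (\<lambda>t. t *\<^sub>R x)"
    using T by (simp add: linear_topology_def o_def)
  then have "open {t. t *\<^sub>R x \<in> U}"
    using openin_continuous_map_preimage[of euclideanreal T "\<lambda>t. t *\<^sub>R x" U] U(1) by simp
  moreover have "(0::real) \<in> {t. t *\<^sub>R x \<in> U}" using U(2) by simp
  ultimately obtain e :: real where e: "0 < e" "ball 0 e \<subseteq> {t. t *\<^sub>R x \<in> U}"
    unfolding open_contains_ball by blast
  then have "e / 2 \<in> ball 0 e" by simp
  with e(2) have "(e / 2) *\<^sub>R x \<in> U" by blast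
  with e(1) show ?thesis by (intro exI[of _ "e / 2"]) simp
qed

lemma linear_topology_continuous_add:
  assumes "linear_topology T" "continuous_map S T f" "continuous_map S T g"
  shows "continuous_map S T (\<lambda>x. f x + g x)"
  using continuous_map_compose[OF continuous_map_pairedI[OF assms(2,3)], of T "\<lambda>(x, y). x + y"] assms(1)
  by (simp add: linear_topology_def o_def)

lemma linear_topology_continuous_scaleR:
  assumes "linear_topology T" "continuous_map S euclideanreal f" "continuous_map S T g"
  shows "continuous_map S T (\<lambda>x. f x *\<^sub>R g x)"
  using continuous_map_compose[OF continuous_map_pairedI[OF assms(2,3)], of T "\<lambda>(x, y). x *\<^sub>R y"] assms(1)
  by (simp add: linear_topology_def o_def)

lemma linear_topology_continuous_sum:
  assumes T: "linear_topology T" and "\<And>i. i \<in> I \<Longrightarrow> continuous_map S T (f i)"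
  shows "continuous_map S T (\<lambda>x. \<Sum>i\<in>I. f i x)"
  using assms(2)
proof (induction I rule: infinite_finite_induct)
  case (insert i I)
  then show ?case
    using linear_topology_continuous_add[OF T, of S "f i" "\<lambda>x. \<Sum>i\<in>I. f i x"] by simp
qed (use T in \<open>auto simp: linear_topology_def\<close>)

text \<open>A linear functional bounded on a neighbourhood of 0 is continuous, by translation and
  scaling.\<close>

lemma polar_subset_dual_space:
  assumes T: "linear_topology T" and U: "openin T U" "0 \<in> U"
  shows "polar U \<subseteq> dual_space T"
proof
  fix f assume f: "f \<in> polar U"
  then have lin: "linear f" by (simp add: polar_def)
  have top: "topspace T = UNIV" using T by (simp add: linear_topology_def)
  have "openin T {x. f x \<in> V}" if V: "open V" for V
  proof (subst openin_subopen, safe)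
    fix x assume "f x \<in> V"
    then obtain e where e: "0 < e" "\<And>z. \<bar>z - f x\<bar> < e \<Longrightarrow> z \<in> V"
      using V by (auto simp: open_dist dist_real_def)
    \<comment> \<open>The factor 2 turns the bound 1 on \<open>U\<close> into \<open>e / 2\<close>,
      which is strictly below \<open>e\<close>.\<close>
    let ?h = "\<lambda>y. (2 / e) *\<^sub>R (y + - x)"
    have "continuous_map T T ?h"
      by (intro linear_topology_continuous_scaleR[OF T] linear_topology_continuous_add[OF T])
        (auto simp: top)
    then have "openin T {y. ?h y \<in> U}"
      using openin_continuous_map_preimage[OF _ U(1)] top by fastforce
    moreover have "f y \<in> V" if "?h y \<in> U" for y
    proof (rule e(2))
      have "\<bar>f (?h y)\<bar> \<le> 1" using f that unfolding polar_def by blast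
      then have "\<bar>(2 / e) * (f y - f x)\<bar> \<le> 1"
        using linear_cmul[OF lin, of "2 / e" "y - x"] linear_diff[OF lin, of y x] by simp
      then have "2 / e * \<bar>f y - f x\<bar> \<le> 1" using e(1) unfolding abs_mult by simp
      moreover have "a \<le> e / 2" if "2 / e * a \<le> 1" for a
        using e(1) that by (simp add: field_simps)
      ultimately have "\<bar>f y - f x\<bar> \<le> e / 2" by blast
      also have "\<dots> < e" using e(1) by simp
      finally show "\<bar>f y - f x\<bar> < e" .
    qed
    ultimately show "\<exists>W. openin T W \<and> x \<in> W \<and> W \<subseteq> {x. f x \<in> V}"
      using U(2) by (intro exI[of _ "{y. ?h y \<in> U}"]) auto
  qed
  then have "continuous_map T euclideanreal f"
    by (simp add: continuous_map_def top)
  with lin show "f \<in> dual_space T" by (simp add: dual_space_def)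
qed

lemma dual_space_span: "span (dual_space T) = dual_space T"
proof -
  have "subspace (dual_space T)"
    unfolding subspace_def
  proof (intro conjI ballI allI)
    show "0 \<in> dual_space T" by (simp add: dual_space_def zero_fun_def linear_zero)
  next
    fix f g assume "f \<in> dual_space T" "g \<in> dual_space T"
    then show "f + g \<in> dual_space T"
      by (auto simp: dual_space_def plus_fun_def intro: linear_compose_add continuous_map_add)
  next
    fix c f assume "f \<in> dual_space T"
    then show "c *\<^sub>R f \<in> dual_space T"
      using linear_compose_scale_right[of f c]
      by (auto simp: dual_space_def scaleR_fun_def intro: continuous_map_real_mult)
  qed
  then show ?thesis by simp
qed

section \<open>The weak topology as an initial topology\<close>

lemma weak_topology_continuous_functional:
  "f \<in> dual_space T \<Longrightarrow> continuous_map (weak_topology T) euclideanreal f"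
  using weak_topology_coarsest[of "weak_topology T" T] by auto

lemma continuous_map_into_weak_topology:
  assumes "\<And>f. f \<in> dual_space T \<Longrightarrow> continuous_map S euclideanreal (\<lambda>x. f (h x))"
  shows "continuous_map S (weak_topology T) h"
  unfolding weak_topology_def
proof (rule continuous_on_generated_topo)
  fix U assume "U \<in> {f -` V |f V. f \<in> dual_space T \<and> open V}"
  then obtain f V where fV: "f \<in> dual_space T" "open V" "U = f -` V" by auto
  have "h -` U \<inter> topspace S = {x \<in> topspace S. f (h x) \<in> V}" using fV by auto
  also have "openin S \<dots>"
    by (rule openin_continuous_map_preimage[OF assms[OF fV(1)]]) (use fV in auto)
  finally show "openin S (h -` U \<inter> topspace S)" .
next
  show "h ` topspace S \<subseteq> \<Union> {f -` V |f V. f \<in> dual_space T \<and> open V}"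
    using topspace_weak_topology[of T]
    unfolding weak_topology_def topology_generated_by_topspace by simp
qed

text \<open>Radius 1 is enough for all functionals at once because the dual space is closed under
  scaling: a radius \<open>e\<close> is absorbed by replacing \<open>f\<close> with
  \<open>inverse e *\<^sub>R f\<close>.\<close>

lemma weak_topology_neighbourhood:
  assumes "openin (weak_topology T) W" "x \<in> W"
  obtains F where "finite F" "F \<subseteq> dual_space T"
    "{y. \<forall>f\<in>F. \<bar>f y - f x\<bar> < 1} \<subseteq> W"
proof -
  have "generate_topology_on {f -` V | f V. f \<in> dual_space T \<and> open V} W"
    using assms(1) unfolding weak_topology_def openin_topology_generated_by_iff .
  then have "x \<in> W \<longrightarrow> (\<exists>F. finite F \<and> F \<subseteq> dual_space T \<and>
      {y. \<forall>f\<in>F. \<bar>f y - f x\<bar> < 1} \<subseteq> W)"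
  proof induction
    case (Int a b)
    show ?case
    proof
      assume "x \<in> a \<inter> b"
      with Int obtain F G where
        "finite F" "F \<subseteq> dual_space T" "{y. \<forall>f\<in>F. \<bar>f y - f x\<bar> < 1} \<subseteq> a"
        "finite G" "G \<subseteq> dual_space T" "{y. \<forall>f\<in>G. \<bar>f y - f x\<bar> < 1} \<subseteq> b"
        by auto
      then show "\<exists>F. finite F \<and> F \<subseteq> dual_space T \<and>
          {y. \<forall>f\<in>F. \<bar>f y - f x\<bar> < 1} \<subseteq> a \<inter> b"
        by (intro exI[of _ "F \<union> G"]) auto
    qed
  next
    case (UN K)
    show ?case
    proof
      assume "x \<in> \<Union>K"
      then obtain k where k: "k \<in> K" "x \<in> k" by blast
      with UN.IH[OF k(1)] obtain F where "finite F" "F \<subseteq> dual_space T"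
        "{y. \<forall>f\<in>F. \<bar>f y - f x\<bar> < 1} \<subseteq> k" by auto
      with k show "\<exists>F. finite F \<and> F \<subseteq> dual_space T \<and>
          {y. \<forall>f\<in>F. \<bar>f y - f x\<bar> < 1} \<subseteq> \<Union>K" by blast
    qed
  next
    case (Basis s)
    then obtain f V where fV: "f \<in> dual_space T" "open V" "s = f -` V" by auto
    show ?case
    proof
      assume "x \<in> s"
      then obtain e where e: "0 < e" "\<And>z. \<bar>z - f x\<bar> < e \<Longrightarrow> z \<in> V"
        using fV by (auto simp: open_dist dist_real_def)
      have "inverse e *\<^sub>R f \<in> dual_space T"
        using span_scale[OF span_base[OF fV(1)], of "inverse e"] by (simp only: dual_space_span)
      moreover have "y \<in> s" if y: "\<bar>(inverse e *\<^sub>R f) y - (inverse e *\<^sub>R f) x\<bar> < 1" for y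
      proof -
        have "(inverse e *\<^sub>R f) y - (inverse e *\<^sub>R f) x = (f y - f x) / e"
          using e(1) by (simp add: scaleR_fun_def divide_inverse algebra_simps)
        then have "\<bar>f y - f x\<bar> / e < 1" using y e(1) by simp
        then have "\<bar>f y - f x\<bar> < e" using e(1) by (simp add: pos_divide_less_eq)
        with e(2) fV show ?thesis by simp
      qed
      ultimately show "\<exists>F. finite F \<and> F \<subseteq> dual_space T \<and>
          {y. \<forall>f\<in>F. \<bar>f y - f x\<bar> < 1} \<subseteq> s"
        by (intro exI[of _ "{inverse e *\<^sub>R f}"]) auto
    qed
  qed auto
  then obtain F where "finite F" "F \<subseteq> dual_space T" "{y. \<forall>f\<in>F. \<bar>f y - f x\<bar> < 1} \<subseteq> W"
    using assms(2) by auto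
  then show thesis by (rule that)
qed

text \<open>A uniform boundedness principle. Each member of the polar is weakly continuous, hence
  bounded on \<open>K\<close>, so the closed sets \<open>C n\<close> of functionals bounded by
  \<open>n\<close> on \<open>K\<close> cover the polar, and the Baire argument applies.\<close>

lemma weakly_compact_polar_bounded:
  assumes T: "linear_topology T" and U: "openin T U" "0 \<in> U"
    and K: "compactin (weak_topology T) K"
  obtains M where "\<And>f x. f \<in> polar U \<Longrightarrow> x \<in> K \<Longrightarrow> \<bar>f x\<bar> \<le> M"
proof -
  have absorb: "\<exists>t>0. t *\<^sub>R x \<in> U" for x by (rule linear_topology_absorbing[OF T U])
  obtain r where r: "\<And>f x. f \<in> polar U \<Longrightarrow> \<bar>f x\<bar> \<le> r x"
    using polar_bounded[OF absorb] by metis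
  define C where "C n = (\<Inter>x\<in>K. {f :: 'a \<Rightarrow> real. \<bar>f x\<bar> \<le> real n})" for n
  have closed: "closed (C n)" for n
    unfolding C_def by (intro closed_INT ballI closed_Collect_le continuous_intros) auto
  have cover: "polar U \<subseteq> (\<Union>n. C n)"
  proof
    fix f assume "f \<in> polar U"
    then have "continuous_map (weak_topology T) euclideanreal f"
      using polar_subset_dual_space[OF T U] weak_topology_continuous_functional by blast
    then have "compact (f ` K)"
      using image_compactin[OF K] by fastforce
    then have "bounded (f ` K)" by (rule compact_imp_bounded)
    then obtain a where a: "\<And>x. x \<in> K \<Longrightarrow> \<bar>f x\<bar> \<le> a"
      by (auto simp: bounded_iff)
    obtain n :: nat where "a \<le> real n" using real_arch_simple by blast
    with a have "f \<in> C n" unfolding C_def by force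
    then show "f \<in> (\<Union>n. C n)" by blast
  qed
  obtain n g t where g: "g \<in> polar U \<inter> C n" "0 < t"
      "\<And>f. f \<in> polar U \<Longrightarrow> (1 - t) *\<^sub>R g + t *\<^sub>R f \<in> C n"
  proof (rule compact_convex_Baire)
    show "compact (polar U)" by (rule compact_polar[OF absorb])
    show "polar U \<noteq> {}" using zero_in_polar by blast
  qed (use r convex_polar closed cover in auto)
  show thesis
  proof (rule that)
    fix f x assume fx: "f \<in> polar U" "x \<in> K"
    have 1: "\<bar>(1 - t) * g x + t * f x\<bar> \<le> n" "\<bar>g x\<bar> \<le> n"
      using g(1) g(3)[OF fx(1)] fx(2) by (auto simp: C_def scaleR_fun_def)
    \<comment> \<open>Both the combination and \<open>g\<close> are bounded by \<open>n\<close> on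
      \<open>K\<close>; solving for \<open>f\<close> bounds it. Only \<open>0 < t\<close> is known,
      whence the absolute value of \<open>1 - t\<close>.\<close>
    have "t * \<bar>f x\<bar> = \<bar>((1 - t) * g x + t * f x) - (1 - t) * g x\<bar>"
      using g(2) by (simp add: abs_mult)
    also have "\<dots> \<le> n + \<bar>1 - t\<bar> * n"
      using 1 mult_left_mono[OF 1(2), of "\<bar>1 - t\<bar>"] by (simp flip: abs_mult)
    finally show "\<bar>f x\<bar> \<le> (n + \<bar>1 - t\<bar> * n) / t"
      using g(2) by (simp add: field_simps)
  qed
qed

section \<open>Ascoli spaces and fans\<close>

lemma first_countable_decreasing_base:
  assumes X: "first_countable X" and x: "x \<in> topspace X"
  obtains D :: "nat \<Rightarrow> 'a set" where "\<And>n. openin X (D n)" "\<And>n. x \<in> D n"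
    "\<And>m n. m \<le> n \<Longrightarrow> D n \<subseteq> D m" "\<And>U. openin X U \<Longrightarrow> x \<in> U \<Longrightarrow> \<exists>n. D n \<subseteq> U"
proof -
  obtain \<B> where \<B>: "countable \<B>" "\<And>V. V \<in> \<B> \<Longrightarrow> openin X V"
    "\<And>U. openin X U \<Longrightarrow> x \<in> U \<Longrightarrow> \<exists>V\<in>\<B>. x \<in> V \<and> V \<subseteq> U"
    using X x unfolding first_countable_def by meson
  \<comment> \<open>Including \<open>topspace X\<close> makes the set to be enumerated visibly
    nonempty.\<close>
  define \<C> where "\<C> = insert (topspace X) {V \<in> \<B>. x \<in> V}"
  have "countable \<C>" using \<B>(1) by (simp add: \<C>_def)
  define b where "b = from_nat_into \<C>"
  have b: "range b = \<C>"
    unfolding b_def by (rule range_from_nat_into) (use \<open>countable \<C>\<close> \<C>_def in auto)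
  define D where "D n = (\<Inter>i\<le>n. b i)" for n
  have mem: "openin X (b i)" "x \<in> b i" for i
  proof -
    have "b i \<in> \<C>" using b by auto
    then show "openin X (b i)" "x \<in> b i" using \<B>(2) x by (auto simp: \<C>_def)
  qed
  show thesis
  proof (rule that)
    show "openin X (D n)" for n
      unfolding D_def by (intro openin_Inter) (use mem in auto)
    show "x \<in> D n" for n using mem by (simp add: D_def)
    show "D n \<subseteq> D m" if "m \<le> n" for m n using that by (auto simp: D_def)
    fix U assume "openin X U" "x \<in> U"
    then obtain V where "V \<in> \<C>" "V \<subseteq> U" using \<B>(3) by (force simp: \<C>_def)
    then obtain i where "b i \<subseteq> U" using b by blast
    then have "D i \<subseteq> U" by (auto simp: D_def)
    then show "\<exists>n. D n \<subseteq> U" by blast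
  qed
qed

lemma openin_compact_open_subbasic:
  assumes "compactin Y C" "open V"
  shows "openin (compact_open_topology Y) {f \<in> continuous_functions Y. f ` C \<subseteq> V}"
  unfolding compact_open_topology_def
  by (rule topology_generated_by_Basis) (use assms in blast)

text \<open>Otherwise there are \<open>f n \<in> K\<close> and points \<open>z n\<close> converging
  to \<open>y\<close> at which \<open>f n\<close> differs from \<open>f n y\<close> by at least
  \<open>e\<close>. Tails of this sequence together with \<open>y\<close> are compact, so the
  compact-open topology controls functions on them, and a finite subcover of \<open>K\<close>
  contradicts the choice of some \<open>f N\<close>.\<close>

lemma first_countable_equicontinuous:
  assumes Y: "first_countable Y" and K: "compactin (compact_open_topology Y) K"
    and y: "y \<in> topspace Y" and e: "0 < e"
  obtains V where "openin Y V" "y \<in> V" "\<And>f z. f \<in> K \<Longrightarrow> z \<in> V \<Longrightarrow> \<bar>f z - f y\<bar> < e"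
proof -
  obtain D :: "nat \<Rightarrow> 'a set" where D: "\<And>n. openin Y (D n)" "\<And>n. y \<in> D n"
    "\<And>m n. m \<le> n \<Longrightarrow> D n \<subseteq> D m" "\<And>U. openin Y U \<Longrightarrow> y \<in> U \<Longrightarrow> \<exists>n. D n \<subseteq> U"
    using first_countable_decreasing_base[OF Y y] by metis
  have KC: "K \<subseteq> continuous_functions Y"
    using compactin_subset_topspace[OF K] by simp
  have "\<exists>n. \<forall>f\<in>K. \<forall>z\<in>D n. \<bar>f z - f y\<bar> < e"
  proof (rule ccontr)
    assume "\<nexists>n. \<forall>f\<in>K. \<forall>z\<in>D n. \<bar>f z - f y\<bar> < e"
    then have "\<forall>n. \<exists>f z. f \<in> K \<and> z \<in> D n \<and> e \<le> \<bar>f z - f y\<bar>"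
      by (meson not_less)
    then obtain f z where fz: "\<And>n. f n \<in> K" "\<And>n. z n \<in> D n" "\<And>n. e \<le> \<bar>f n (z n) - f n y\<bar>"
      by metis
    have lim: "limitin Y z y sequentially"
      unfolding limitin_sequentially
    proof (intro conjI allI impI y)
      fix U assume "openin Y U \<and> y \<in> U"
      then obtain N where "D N \<subseteq> U" using D(4) by blast
      then have "\<forall>n\<ge>N. z n \<in> U" using fz(2) D(3) by blast
      then show "\<exists>N. \<forall>n\<ge>N. z n \<in> U" by blast
    qed
    have zY: "z n \<in> topspace Y" for n using fz(2) D(1) openin_subset by blast
    define S where "S N = insert y (z ` {N..})" for N
    have S: "compactin Y (S N)" for N
      unfolding S_def by (rule compactin_sequence_with_limit[OF lim]) (use zY in auto)
    \<comment> \<open>For \<open>p = (N, c)\<close> these functions map the whole tail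
      \<open>S N\<close> within \<open>e / 2\<close> of \<open>c\<close>. By continuity each
      \<open>g \<in> K\<close> lies in \<open>W (N, g y)\<close> for some \<open>N\<close>.\<close>
    define W where "W p = {g \<in> continuous_functions Y. g ` S (fst p) \<subseteq> ball (snd p) (e / 2)}"
      for p :: "nat \<times> real"
    have W_open: "openin (compact_open_topology Y) (W p)" for p
      unfolding W_def by (rule openin_compact_open_subbasic[OF S open_ball])
    have W_cover: "K \<subseteq> \<Union> (range W)"
    proof
      fix g assume g: "g \<in> K"
      then have cont: "continuous_map Y euclideanreal g"
        using KC by (auto simp: continuous_functions_def)
      have "openin Y {z \<in> topspace Y. g z \<in> ball (g y) (e / 2)}"
        by (rule openin_continuous_map_preimage[OF cont]) simp
      moreover have "y \<in> {z \<in> topspace Y. g z \<in> ball (g y) (e / 2)}" using y e by simp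
      ultimately obtain N where "\<forall>n\<ge>N. g (z n) \<in> ball (g y) (e / 2)"
        using lim unfolding limitin_sequentially by blast
      then have "g \<in> W (N, g y)" using g KC e by (auto simp: W_def S_def)
      then show "g \<in> \<Union> (range W)" by blast
    qed
    have "\<exists>\<F>. finite \<F> \<and> \<F> \<subseteq> range W \<and> K \<subseteq> \<Union>\<F>"
      by (rule compactinD[OF K]) (use W_open W_cover in auto)
    then obtain P where P: "finite P" "K \<subseteq> \<Union> (W ` P)"
      by (metis finite_subset_image)
    \<comment> \<open>Past all tail indices of the subcover, so \<open>z N\<close> belongs to every
      tail that occurs in it.\<close>
    define N where "N = Max (insert 0 (fst ` P))"
    obtain p where p: "p \<in> P" "f N \<in> W p" using fz(1)[of N] P(2) by blast
    then have "fst p \<le> N" using P(1) by (simp add: N_def)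
    then have "z N \<in> S (fst p)" "y \<in> S (fst p)" by (auto simp: S_def)
    then have "f N (z N) \<in> ball (snd p) (e / 2)" "f N y \<in> ball (snd p) (e / 2)"
      using p(2) unfolding W_def by blast+
    then have "dist (f N (z N)) (f N y) < e"
      using dist_triangle_half_r[of "snd p" "f N (z N)" e "f N y"] by simp
    then have "\<bar>f N (z N) - f N y\<bar> < e" by (simp add: dist_real_def)
    with fz(3)[of N] show False by simp
  qed
  with D that show thesis by metis
qed

text \<open>Joint continuity at \<open>(f, y)\<close> splits into equicontinuity of \<open>K\<close>
  at \<open>y\<close>, which bounds \<open>\<bar>g z - g y\<bar>\<close>, and closeness of
  \<open>g\<close> to \<open>f\<close> at the single point \<open>y\<close>.\<close>

lemma metrizable_imp_Ascoli_space:
  assumes Y: "metrizable_space Y"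
  shows "Ascoli_space Y"
  unfolding Ascoli_space_def Tychonoff_space_def
proof (intro conjI allI impI)
  show "completely_regular_space Y" "Hausdorff_space Y"
    using Y by (auto intro: metrizable_imp_completely_regular_space metrizable_imp_Hausdorff_space)
next
  fix K assume K: "compactin (compact_open_topology Y) K"
  let ?Z = "subtopology (compact_open_topology Y) K"
  have KC: "K \<subseteq> continuous_functions Y"
    using compactin_subset_topspace[OF K] by simp
  have "openin (prod_topology ?Z Y) {p \<in> K \<times> topspace Y. fst p (snd p) \<in> V}" if V: "open V" for V
  proof (subst openin_subopen, safe)
    fix f y assume fy: "f \<in> K" "y \<in> topspace Y" "fst (f, y) (snd (f, y)) \<in> V"
    then obtain e where e: "0 < e" "\<And>z. \<bar>z - f y\<bar> < e \<Longrightarrow> z \<in> V"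
      using V by (auto simp: open_dist dist_real_def)
    obtain U where U: "openin Y U" "y \<in> U" "\<And>g z. g \<in> K \<Longrightarrow> z \<in> U \<Longrightarrow> \<bar>g z - g y\<bar> < e / 2"
      using first_countable_equicontinuous[OF metrizable_imp_first_countable[OF Y] K fy(2), of "e / 2"]
        e(1) by auto
    define W where "W = {g \<in> continuous_functions Y. g ` {y} \<subseteq> ball (f y) (e / 2)} \<inter> K"
    have "openin ?Z W"
      unfolding W_def
      by (intro openin_subtopology_Int openin_compact_open_subbasic) (use fy(2) in auto)
    then have "openin (prod_topology ?Z Y) (W \<times> U)"
      using U(1) by (simp add: openin_prod_Times_iff)
    moreover have "(f, y) \<in> W \<times> U" using fy KC e(1) U(2) by (auto simp: W_def)
    moreover have "W \<times> U \<subseteq> {p \<in> K \<times> topspace Y. fst p (snd p) \<in> V}"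
    proof
      fix p assume p: "p \<in> W \<times> U"
      then obtain g z where gz: "p = (g, z)" "g \<in> W" "z \<in> U" by auto
      then have "\<bar>g y - f y\<bar> < e / 2" "g \<in> K" by (auto simp: W_def dist_real_def abs_minus_commute)
      with U(3)[OF \<open>g \<in> K\<close> gz(3)] have "\<bar>g z - f y\<bar> < e"
        using abs_triangle_ineq[of "g z - g y" "g y - f y"] by simp
      with e(2) gz \<open>g \<in> K\<close> openin_subset[OF U(1)]
      show "p \<in> {p \<in> K \<times> topspace Y. fst p (snd p) \<in> V}" by auto
    qed
    ultimately show "\<exists>Q. openin (prod_topology ?Z Y) Q \<and> (f, y) \<in> Q \<and>
        Q \<subseteq> {p \<in> K \<times> topspace Y. fst p (snd p) \<in> V}" by blast
  qed
  moreover have "topspace ?Z = K" using KC by auto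
  ultimately show "continuous_map (prod_topology ?Z Y) euclideanreal (\<lambda>(f, y). f y)"
    by (simp add: continuous_map_def case_prod_beta)
qed

text \<open>The maximum of the bumps at the points of \<open>F\<close> works; carrying the upper
  bound 1 through the induction keeps its value on \<open>F\<close> exactly 1.\<close>

lemma R_open_finite_bump:
  assumes U: "R_open Y U" and F: "finite F" "F \<subseteq> U"
  obtains f where "continuous_map Y euclideanreal f" "\<And>y. y \<in> F \<Longrightarrow> f y = 1"
    "\<And>y. y \<in> topspace Y - U \<Longrightarrow> f y = 0"
proof -
  have "\<exists>f. continuous_map Y euclideanreal f \<and> (\<forall>y\<in>topspace Y. f y \<le> 1) \<and> (\<forall>y\<in>F. f y = 1) \<and>
      (\<forall>y\<in>topspace Y - U. f y = 0)"
    using F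
  proof (induction F rule: finite_induct)
    case empty
    show ?case by (intro exI[of _ "\<lambda>_. 0"]) simp
  next
    case (insert x F)
    then obtain f where f: "continuous_map Y euclideanreal f" "\<forall>y\<in>topspace Y. f y \<le> 1"
      "\<forall>y\<in>F. f y = 1" "\<forall>y\<in>topspace Y - U. f y = 0"
      by auto
    have "x \<in> U" using insert.prems by simp
    then obtain g where g: "continuous_map Y (top_of_set {0..1::real}) g" "g x = 1"
      "g ` (topspace Y - U) \<subseteq> {0}"
      using U unfolding R_open_def by blast
    have UY: "U \<subseteq> topspace Y" using U by (simp add: R_open_def)
    have g': "continuous_map Y euclideanreal g" "\<forall>y\<in>topspace Y. g y \<le> 1"
      using g(1) by (auto simp: continuous_map_in_subtopology)
    have "max (f y) (g y) = 1" if "y \<in> insert x F" for y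
    proof -
      have "y \<in> topspace Y" using that insert.prems UY by blast
      then show ?thesis
        using that f(2,3) g(2) g'(2) by (force simp: max_def)
    qed
    with f g(3) g' show ?case
      by (intro exI[of _ "\<lambda>y. max (f y) (g y)"]) (auto intro: continuous_map_real_max)
  qed
  with that show thesis by blast
qed

text \<open>Bumps \<open>g n\<close> equal to 1 on \<open>F n\<close> and 0 off \<open>U n\<close>
  converge to 0 in the compact-open topology, since a compact set meets only finitely many
  \<open>U n\<close>. The sequence with its limit is compact, yet evaluation is discontinuous at the
  zero function and a point \<open>y\<close> where local finiteness fails: near \<open>y\<close> the
  value 1 is attained for infinitely many \<open>n\<close>.\<close>

lemma Ascoli_space_imp_no_strong_Fin_fan:
  assumes Y: "Ascoli_space Y"
  shows "\<not> strong_Fin_fan Y F"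
proof
  assume fan: "strong_Fin_fan Y F"
  then obtain U where U: "\<And>n. R_open Y (U n)" "\<And>n. F n \<subseteq> U n" "compact_finite_family Y U"
    unfolding strong_Fin_fan_def by blast
  have F: "finite (F n)" "F n \<subseteq> topspace Y" for n
    using fan by (auto simp: strong_Fin_fan_def Fin_fan_def)
  have "\<not> locally_finite_family Y F" using fan by (simp add: strong_Fin_fan_def Fin_fan_def)
  then obtain y where y: "y \<in> topspace Y"
    "\<And>V. openin Y V \<Longrightarrow> y \<in> V \<Longrightarrow> infinite {n. V \<inter> F n \<noteq> {}}"
    unfolding locally_finite_family_def by metis
  have "\<exists>f. continuous_map Y euclideanreal f \<and> (\<forall>y\<in>F n. f y = 1) \<and>
      (\<forall>y\<in>topspace Y - U n. f y = 0)" for n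
    using R_open_finite_bump[OF U(1) F(1) U(2)] by metis
  then obtain f where f: "\<And>n. continuous_map Y euclideanreal (f n)" "\<And>n y. y \<in> F n \<Longrightarrow> f n y = 1"
    "\<And>n y. y \<in> topspace Y - U n \<Longrightarrow> f n y = 0"
    by metis
  define g where "g n = restrict (f n) (topspace Y)" for n
  define z where "z = restrict (\<lambda>_. 0 :: real) (topspace Y)"
  have cf: "restrict h (topspace Y) \<in> continuous_functions Y"
    if "continuous_map Y euclideanreal h" for h
    using that unfolding continuous_functions_def
    by (auto intro: continuous_map_eq)
  have gC: "g n \<in> continuous_functions Y" for n unfolding g_def by (rule cf[OF f(1)])
  have zC: "z \<in> continuous_functions Y" unfolding z_def by (rule cf) simp
  have ev: "\<exists>N. \<forall>n\<ge>N. g n \<in> W" if "openin (compact_open_topology Y) W" "z \<in> W" for W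
  proof -
    have "generate_topology_on
        {{f \<in> continuous_functions Y. f ` K \<subseteq> V} | K V. compactin Y K \<and> open V} W"
      using that(1) unfolding compact_open_topology_def openin_topology_generated_by_iff .
    then have "z \<in> W \<longrightarrow> (\<exists>N. \<forall>n\<ge>N. g n \<in> W)"
    proof induction
      case (Int a b)
      show ?case
      proof
        assume "z \<in> a \<inter> b"
        with Int obtain M N where "\<forall>n\<ge>M. g n \<in> a" "\<forall>n\<ge>N. g n \<in> b" by blast
        then show "\<exists>N. \<forall>n\<ge>N. g n \<in> a \<inter> b" by (intro exI[of _ "max M N"]) auto
      qed
    next
      case (UN \<K>)
      then show ?case by (metis UnionE UnionI)
    next
      case (Basis s)
      then obtain C V where CV: "compactin Y C" "open V" "s = {f \<in> continuous_functions Y. f ` C \<subseteq> V}"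
        by blast
      have CY: "C \<subseteq> topspace Y" by (rule compactin_subset_topspace[OF CV(1)])
      show ?case
      proof
        assume "z \<in> s"
        \<comment> \<open>This is claimed only when \<open>C\<close> has a point: for empty
          \<open>C\<close> the set \<open>V\<close> may miss 0.\<close>
        then have 0: "0 \<in> V" if "x \<in> C" for x using that CY CV(3) by (auto simp: z_def)
        have "finite {n. C \<inter> U n \<noteq> {}}"
          using U(3) CV(1) by (simp add: compact_finite_family_def)
        then obtain N where N: "\<forall>n\<in>{n. C \<inter> U n \<noteq> {}}. n < N"
          using finite_nat_set_iff_bounded by blast
        have "g n \<in> s" if "N \<le> n" for n
        proof -
          have "C \<inter> U n = {}" using N that by auto
          then have "g n x \<in> V" if "x \<in> C" for x
          proof -
            have "x \<in> topspace Y - U n" using that CY \<open>C \<inter> U n = {}\<close> by blast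
            then show ?thesis using f(3) 0[OF that] by (simp add: g_def)
          qed
          then show ?thesis using gC CV(3) by auto
        qed
        then show "\<exists>N. \<forall>n\<ge>N. g n \<in> s" by blast
      qed
    qed auto
    with that(2) show ?thesis by blast
  qed
  define K where "K = insert z (range g)"
  have "limitin (compact_open_topology Y) g z sequentially"
    unfolding limitin_sequentially using zC ev by simp
  then have "compactin (compact_open_topology Y) K"
    unfolding K_def by (rule compactin_sequence_with_limit) (use gC in auto)
  then have cont: "continuous_map (prod_topology (subtopology (compact_open_topology Y) K) Y)
        euclideanreal (\<lambda>(f, y). f y)" (is "continuous_map ?P _ ?e")
    using Y by (simp add: Ascoli_space_def)
  have "openin ?P {p \<in> topspace ?P. ?e p \<in> {..<1}}"
    by (rule openin_continuous_map_preimage[OF cont]) simp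
  moreover have "(z, y) \<in> {p \<in> topspace ?P. ?e p \<in> {..<1}}"
    using y(1) zC by (auto simp: K_def z_def)
  ultimately obtain A V where AV: "openin (subtopology (compact_open_topology Y) K) A" "openin Y V"
    "z \<in> A" "y \<in> V" "A \<times> V \<subseteq> {p \<in> topspace ?P. ?e p \<in> {..<1}}"
    unfolding openin_prod_topology_alt by meson
  obtain W where W: "openin (compact_open_topology Y) W" "A = W \<inter> K"
    using AV(1) by (auto simp: openin_subtopology)
  obtain N where N: "\<forall>n\<ge>N. g n \<in> W" using ev[OF W(1)] AV(3) W(2) by blast
  obtain n where n: "N \<le> n" "V \<inter> F n \<noteq> {}"
    using y(2)[OF AV(2,4)] unfolding infinite_nat_iff_unbounded_le by blast
  then obtain x where x: "x \<in> V" "x \<in> F n" by blast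
  have "(g n, x) \<in> A \<times> V" using N n(1) W(2) x(1) by (auto simp: K_def)
  then have "g n x < 1" using AV(5) by auto
  moreover have "g n x = 1" using f(2)[OF x(2)] F(2) x(2) by (auto simp: g_def)
  ultimately show False by simp
qed

section \<open>Fans from infinite-dimensional polars\<close>

text \<open>A decreasing neighbourhood base has increasing polars, and every continuous functional
  takes values in \<open>(-1, 1)\<close> on some member of the base.\<close>

lemma dual_space_countable_Union_polars:
  assumes T: "linear_topology T" "first_countable T"
  obtains D :: "nat \<Rightarrow> 'a::real_vector set" where "\<And>n. openin T (D n)" "\<And>n. 0 \<in> D n"
    "\<And>m n. m \<le> n \<Longrightarrow> polar (D m) \<subseteq> polar (D n)" "dual_space T = (\<Union>n. polar (D n))"
proof -
  have "0 \<in> topspace T" using T(1) by (simp add: linear_topology_def)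
  then obtain D :: "nat \<Rightarrow> 'a set" where D: "\<And>n. openin T (D n)" "\<And>n. 0 \<in> D n"
    "\<And>m n. m \<le> n \<Longrightarrow> D n \<subseteq> D m" "\<And>U. openin T U \<Longrightarrow> 0 \<in> U \<Longrightarrow> \<exists>n. D n \<subseteq> U"
    using first_countable_decreasing_base[OF T(2)] by metis
  show thesis
  proof (rule that)
    show "openin T (D n)" "0 \<in> D n" for n using D by auto
    show "polar (D m) \<subseteq> polar (D n)" if "m \<le> n" for m n
      using D(3)[OF that] unfolding polar_def by blast
    show "dual_space T = (\<Union>n. polar (D n))"
    proof
      show "(\<Union>n. polar (D n)) \<subseteq> dual_space T"
        using polar_subset_dual_space[OF T(1) D(1,2)] by blast
      show "dual_space T \<subseteq> (\<Union>n. polar (D n))"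
      proof
        fix f assume f: "f \<in> dual_space T"
        then have cont: "continuous_map T euclideanreal f" and lin: "linear f"
          by (auto simp: dual_space_def)
        have "openin T {x \<in> topspace T. f x \<in> {-1<..<1}}"
          by (rule openin_continuous_map_preimage[OF cont]) simp
        then obtain n where "D n \<subseteq> {x \<in> topspace T. f x \<in> {-1<..<1}}"
          using D(4)[of "{x \<in> topspace T. f x \<in> {-1<..<1}}"] \<open>0 \<in> topspace T\<close> linear_0[OF lin]
          by auto
        then have "\<bar>f x\<bar> \<le> 1" if "x \<in> D n" for x using that by fastforce
        then show "f \<in> (\<Union>n. polar (D n))" using lin by (auto simp: polar_def)
      qed
    qed
  qed
qed

lemma R_open_polar_super_level:
  assumes T: "linear_topology T" and U: "openin T U" "0 \<in> U" and a: "0 \<le> a"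
  shows "R_open (weak_topology T) {x. \<exists>f\<in>polar U. a < \<bar>f x\<bar>}"
  unfolding R_open_def
proof (intro conjI ballI)
  fix y assume "y \<in> {x. \<exists>f\<in>polar U. a < \<bar>f x\<bar>}"
  then obtain f where f: "f \<in> polar U" "a < \<bar>f y\<bar>" by blast
  \<comment> \<open>Only the one functional \<open>f\<close> witnessing \<open>y\<close> is used;
    truncating the rescaled \<open>\<bar>f x\<bar>\<close> gives a weakly continuous bump that is 0
    wherever \<open>\<bar>f x\<bar> \<le> a\<close>.\<close>
  define h where "h x = min 1 (max 0 ((\<bar>f x\<bar> - a) / (\<bar>f y\<bar> - a)))" for x
  have "continuous_map (weak_topology T) euclideanreal f"
    using polar_subset_dual_space[OF T U] f(1) weak_topology_continuous_functional by blast
  then have "continuous_map (weak_topology T) euclideanreal h"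
    unfolding h_def divide_inverse by (intro continuous_intros) auto
  then have "continuous_map (weak_topology T) (top_of_set {0..1}) h"
    by (auto simp: continuous_map_in_subtopology h_def)
  moreover have "h y = 1" using f(2) by (simp add: h_def)
  moreover have "h x = 0" if "x \<notin> {x. \<exists>f\<in>polar U. a < \<bar>f x\<bar>}" for x
  proof -
    have "\<bar>f x\<bar> \<le> a" using that f(1) by force
    then have "(\<bar>f x\<bar> - a) / (\<bar>f y\<bar> - a) \<le> 0" using f(2) by (intro divide_nonpos_pos) auto
    then show ?thesis by (simp add: h_def)
  qed
  ultimately show "\<exists>h. continuous_map (weak_topology T) (top_of_set {0..1::real}) h \<and> h y = 1 \<and>
      h ` (topspace (weak_topology T) - {x. \<exists>f\<in>polar U. a < \<bar>f x\<bar>}) \<subseteq> {0}"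
    by (intro exI[of _ h]) auto
qed simp

lemma compact_finite_polar_super_levels:
  assumes T: "linear_topology T" and U: "openin T U" "0 \<in> U"
  shows "compact_finite_family (weak_topology T) (\<lambda>n. {x. \<exists>f\<in>polar U. real n < \<bar>f x\<bar>})"
  unfolding compact_finite_family_def
proof (intro allI impI)
  fix K assume K: "compactin (weak_topology T) K"
  obtain M where M: "\<And>f x. f \<in> polar U \<Longrightarrow> x \<in> K \<Longrightarrow> \<bar>f x\<bar> \<le> M"
    using weakly_compact_polar_bounded[OF T U K] by metis
  have "n \<le> nat \<lceil>M\<rceil>" if ne: "K \<inter> {x. \<exists>f\<in>polar U. real n < \<bar>f x\<bar>} \<noteq> {}" for n
  proof -
    obtain x f where "x \<in> K" "f \<in> polar U" "real n < \<bar>f x\<bar>" using ne by blast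
    with M have "real n < M" by force
    then show ?thesis by linarith
  qed
  then have "{n. K \<inter> {x. \<exists>f\<in>polar U. real n < \<bar>f x\<bar>} \<noteq> {}} \<subseteq> {..nat \<lceil>M\<rceil>}" by blast
  then show "finite {n. K \<inter> {x. \<exists>f\<in>polar U. real n < \<bar>f x\<bar>} \<noteq> {}}"
    by (rule finite_subset) simp
qed

lemma finite_set_small_on_tuples:
  fixes P S :: "('a::real_vector \<Rightarrow> real) set"
  assumes P: "compact P" "\<And>f. f \<in> P \<Longrightarrow> linear f"
    and S: "infinite S" "independent S" "\<And>f. f \<in> S \<Longrightarrow> linear f"
  obtains F where "finite F" "F \<subseteq> {x. \<exists>f\<in>S. a < \<bar>f x\<bar>}"
    "\<And>g. (\<And>i. g i \<in> P) \<Longrightarrow> \<exists>x\<in>F. \<forall>i<n::nat. \<bar>g i x\<bar> < 1"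
proof -
  \<comment> \<open>Tuples are represented by infinite sequences, which Tychonoff's theorem covers
    directly; \<open>N x\<close> restricts only the first \<open>n\<close> entries.\<close>
  define Q where "Q = (PiE UNIV (\<lambda>_. P) :: (nat \<Rightarrow> 'a \<Rightarrow> real) set)"
  define N where "N x = {g :: nat \<Rightarrow> 'a \<Rightarrow> real. \<forall>i<n. \<bar>g i x\<bar> < 1}" for x
  have "compactin (product_topology (\<lambda>_. euclidean) UNIV) Q"
    unfolding Q_def using P(1) by (simp add: compactin_PiE)
  then have Q: "compact Q" by (simp add: euclidean_product_topology)
  have N: "open (N x)" for x
  proof -
    have "continuous_on UNIV (\<lambda>g :: nat \<Rightarrow> 'a \<Rightarrow> real. g i x)" for i
      by (rule continuous_on_product_then_coordinatewise[OF continuous_on_product_coordinates])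
    then have "open {g :: nat \<Rightarrow> 'a \<Rightarrow> real. \<bar>g i x\<bar> < 1}" for i
      by (intro open_Collect_less continuous_on_rabs continuous_on_const)
    then have "open (\<Inter>i\<in>{..<n}. {g :: nat \<Rightarrow> 'a \<Rightarrow> real. \<bar>g i x\<bar> < 1})"
      by (intro open_INT) auto
    also have "(\<Inter>i\<in>{..<n}. {g :: nat \<Rightarrow> 'a \<Rightarrow> real. \<bar>g i x\<bar> < 1}) = N x"
      by (auto simp: N_def)
    finally show ?thesis .
  qed
  have cover: "Q \<subseteq> (\<Union>x\<in>{x. \<exists>f\<in>S. a < \<bar>f x\<bar>}. N x)"
  proof
    fix g assume g: "g \<in> Q"
    let ?G = "g ` {..<n}"
    have G: "finite ?G" "\<And>f. f \<in> ?G \<Longrightarrow> linear f"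
      using g P(2) by (auto simp: Q_def)
    \<comment> \<open>An infinite independent set does not fit into the span of finitely many
      vectors, so some \<open>s \<in> S\<close> is nonzero on the common kernel of the
      tuple.\<close>
    have "\<not> S \<subseteq> span ?G"
      using independent_span_bound[OF G(1) S(2)] S(1) by blast
    then obtain s where s: "s \<in> S" "s \<notin> span ?G" by blast
    obtain x where x: "\<And>f. f \<in> ?G \<Longrightarrow> f x = 0" "s x \<noteq> 0"
      using common_kernel_separates[OF G S(3)[OF s(1)] s(2)] by metis
    \<comment> \<open>Scaling inside the common kernel raises the value of \<open>s\<close> to
      \<open>\<bar>a\<bar> + 1\<close> and leaves the tuple at 0.\<close>
    define c where "c = (\<bar>a\<bar> + 1) / s x"
    have "s (c *\<^sub>R x) = \<bar>a\<bar> + 1"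
      using x(2) linear_cmul[OF S(3)[OF s(1)], of c x] by (simp add: c_def)
    then have "a < \<bar>s (c *\<^sub>R x)\<bar>" by simp
    moreover have "g i (c *\<^sub>R x) = 0" if "i < n" for i
      using that x(1) linear_cmul[OF G(2), of "g i" c x] by simp
    then have "g \<in> N (c *\<^sub>R x)" by (simp add: N_def)
    ultimately show "g \<in> (\<Union>x\<in>{x. \<exists>f\<in>S. a < \<bar>f x\<bar>}. N x)" using s(1) by blast
  qed
  obtain F where F: "F \<subseteq> {x. \<exists>f\<in>S. a < \<bar>f x\<bar>}" "finite F" "Q \<subseteq> (\<Union>x\<in>F. N x)"
    by (rule compactE_image[OF Q N cover])
  show thesis
  proof (rule that[OF F(2,1)])
    fix g :: "nat \<Rightarrow> 'a \<Rightarrow> real" assume "\<And>i. g i \<in> P"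
    then have "g \<in> Q" by (auto simp: Q_def)
    then show "\<exists>x\<in>F. \<forall>i<n. \<bar>g i x\<bar> < 1" using F(3) by (auto simp: N_def)
  qed
qed

text \<open>The \<open>n\<close>-th finite set handles \<open>n\<close>-tuples from the
  \<open>n\<close>-th polar. A weak neighbourhood of 0 is given by finitely many functionals, which
  form such a tuple for all large \<open>n\<close>, so it meets almost all members of the
  family.\<close>

lemma infinite_dimensional_polar_strong_Fin_fan:
  assumes T: "linear_topology T" "first_countable T" and U: "openin T U" "0 \<in> U"
    and S: "infinite S" "independent S" "S \<subseteq> polar U"
  obtains F where "strong_Fin_fan (weak_topology T) F"
proof -
  obtain D :: "nat \<Rightarrow> 'a set" where D: "\<And>n. openin T (D n)" "\<And>n. 0 \<in> D n"
    "\<And>m n. m \<le> n \<Longrightarrow> polar (D m) \<subseteq> polar (D n)" "dual_space T = (\<Union>n. polar (D n))"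
    using dual_space_countable_Union_polars[OF T] by metis
  define small where "small n F \<longleftrightarrow> finite F \<and> F \<subseteq> {x. \<exists>f\<in>S. real n < \<bar>f x\<bar>} \<and>
      (\<forall>g. (\<forall>i. g i \<in> polar (D n)) \<longrightarrow> (\<exists>x\<in>F. \<forall>i<n. \<bar>g i x\<bar> < 1))" for n F
  have "\<exists>F. small n F" for n
  proof -
    obtain F where "finite F" "F \<subseteq> {x. \<exists>f\<in>S. real n < \<bar>f x\<bar>}"
      "\<And>g. (\<And>i. g i \<in> polar (D n)) \<Longrightarrow> \<exists>x\<in>F. \<forall>i<n. \<bar>g i x\<bar> < 1"
    proof (rule finite_set_small_on_tuples)
      show "compact (polar (D n))"
        by (rule compact_polar[OF linear_topology_absorbing[OF T(1) D(1,2)]])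
    qed (use S in \<open>auto simp: polar_def\<close>)
    then show ?thesis unfolding small_def by blast
  qed
  then obtain F where "\<And>n. small n (F n)" by metis
  then have F: "finite (F n)" "F n \<subseteq> {x. \<exists>f\<in>S. real n < \<bar>f x\<bar>}"
    "(\<And>i. g i \<in> polar (D n)) \<Longrightarrow> \<exists>x\<in>F n. \<forall>i<n. \<bar>g i x\<bar> < 1" for n g
    by (simp_all add: small_def)
  let ?O = "\<lambda>n. {x. \<exists>f\<in>polar U. real n < \<bar>f x\<bar>}"
  have FO: "F n \<subseteq> ?O n" for n using F(2) S(3) by blast
  have fin: "compact_finite_family (weak_topology T) ?O"
    by (rule compact_finite_polar_super_levels[OF T(1) U])
  have "compact_finite_family (weak_topology T) F"
    unfolding compact_finite_family_def
  proof (intro allI impI)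
    fix K assume "compactin (weak_topology T) K"
    then have "finite {n. K \<inter> ?O n \<noteq> {}}" using fin by (simp add: compact_finite_family_def)
    moreover have "{n. K \<inter> F n \<noteq> {}} \<subseteq> {n. K \<inter> ?O n \<noteq> {}}" using FO by blast
    ultimately show "finite {n. K \<inter> F n \<noteq> {}}" by (rule rev_finite_subset)
  qed
  moreover have "\<not> locally_finite_family (weak_topology T) F"
  proof
    assume "locally_finite_family (weak_topology T) F"
    then obtain W where W: "openin (weak_topology T) W" "0 \<in> W" "finite {n. W \<inter> F n \<noteq> {}}"
      by (auto simp: locally_finite_family_def)
    obtain G where G: "finite G" "G \<subseteq> dual_space T" "{y. \<forall>f\<in>G. \<bar>f y - f 0\<bar> < 1} \<subseteq> W"
      using weak_topology_neighbourhood[OF W(1,2)] .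
    have "\<exists>k. G \<subseteq> polar (D k)"
      using G(1,2)
    proof (induction G rule: finite_induct)
      case (insert f G)
      then obtain k m where "G \<subseteq> polar (D k)" "f \<in> polar (D m)" using D(4) by blast
      then show ?case
        using D(3)[of k "max k m"] D(3)[of m "max k m"] by (intro exI[of _ "max k m"]) auto
    qed simp
    then obtain k where k: "G \<subseteq> polar (D k)" by blast
    obtain m h where h: "G = h ` {i::nat. i < m}"
      using finite_imp_nat_seg_image_inj_on[OF G(1)] by blast
    have "W \<inter> F n \<noteq> {}" if n: "max k m \<le> n" for n
    proof -
      \<comment> \<open>The enumeration of \<open>G\<close> is padded with 0, which lies in every
        polar. For \<open>n \<ge> max k m\<close> all entries belong to \<open>polar (D n)\<close>
        and \<open>G\<close> is listed among the first \<open>n\<close>.\<close>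
      define g where "g i = (if i < m then h i else 0)" for i
      have "g i \<in> polar (D n)" for i
        using D(3)[of k n] k n h zero_in_polar by (auto simp: g_def)
      then obtain x where x: "x \<in> F n" "\<forall>i<n. \<bar>g i x\<bar> < 1" using F(3)[of g n] by blast
      have "\<bar>f x - f 0\<bar> < 1" if f: "f \<in> G" for f
      proof -
        have "f 0 = 0" using k f by (auto simp: polar_def linear_0)
        moreover obtain i where "i < m" "f = g i" using f h by (auto simp: g_def)
        ultimately show ?thesis using x(2) n by simp
      qed
      then show ?thesis using G(3) x(1) by blast
    qed
    then have "{max k m..} \<subseteq> {n. W \<inter> F n \<noteq> {}}" by auto
    then show False using W(3) infinite_Ici finite_subset by blast
  qed
  ultimately have "Fin_fan (weak_topology T) F" using F(1) by (simp add: Fin_fan_def)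
  moreover have "R_open (weak_topology T) (?O n)" for n
    by (rule R_open_polar_super_level[OF T(1) U]) simp
  ultimately have "strong_Fin_fan (weak_topology T) F"
    unfolding strong_Fin_fan_def using FO fin by (intro conjI exI[of _ ?O] allI)
  then show thesis by (rule that)
qed

text \<open>Without fans, maximal independent subsets of the polars are finite. Their union is
  countable and spans the dual space, so a maximal independent subset of it is the desired
  basis.\<close>

lemma no_strong_Fin_fan_imp_countable_dual:
  assumes T: "linear_topology T" "first_countable T"
    and no_fan: "\<nexists>F. strong_Fin_fan (weak_topology T) F"
  shows "\<exists>B. countable B \<and> hamel_basis (dual_space T) B"
proof -
  obtain D :: "nat \<Rightarrow> 'a set" where D: "\<And>n. openin T (D n)" "\<And>n. 0 \<in> D n"
    "dual_space T = (\<Union>n. polar (D n))"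
    using dual_space_countable_Union_polars[OF T] by metis
  have "\<exists>C. C \<subseteq> polar (D n) \<and> independent C \<and> polar (D n) \<subseteq> span C" for n
    using maximal_independent_subset[of "polar (D n)"] by metis
  then obtain C where C: "\<And>n. C n \<subseteq> polar (D n)" "\<And>n. independent (C n)"
    "\<And>n. polar (D n) \<subseteq> span (C n)"
    by metis
  have "finite (C n)" for n
    using infinite_dimensional_polar_strong_Fin_fan[OF T D(1,2) _ C(2,1)] no_fan by blast
  then have count: "countable (\<Union>n. C n)" by (simp add: countable_finite)
  obtain B where B: "B \<subseteq> (\<Union>n. C n)" "independent B" "(\<Union>n. C n) \<subseteq> span B"
    using maximal_independent_subset[of "\<Union>n. C n"] by metis
  have BD: "B \<subseteq> dual_space T" using B(1) C(1) D(3) by blast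
  have "span (C n) \<subseteq> span B" for n
    by (rule span_minimal) (use B(3) in auto)
  then have "dual_space T \<subseteq> span B" using C(3) D(3) by blast
  moreover have "span B \<subseteq> dual_space T" using span_mono[OF BD] by (simp only: dual_space_span)
  ultimately have "hamel_basis (dual_space T) B" using BD B(2) by (simp add: hamel_basis_def)
  then show ?thesis using countable_subset[OF B(1) count] by blast
qed

section \<open>Countable-dimensional duals\<close>

text \<open>The polar is covered by the increasing closed sets \<open>E n\<close>. By the Baire
  argument a shrunken copy of it lies in one \<open>E n\<close> together with its centre
  \<open>g\<close>, and solving for \<open>f\<close> puts the whole polar there.\<close>

lemma countable_dual_polar_finite:
  fixes b :: "nat \<Rightarrow> 'a::real_vector \<Rightarrow> real"
  assumes T: "linear_topology T" and U: "openin T U" "0 \<in> U"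
    and b: "dual_space T \<subseteq> span (range b)"
  obtains n where "\<And>f x. f \<in> polar U \<Longrightarrow> (\<And>i. i < n \<Longrightarrow> b i x = 0) \<Longrightarrow> f x = 0"
proof -
  have absorb: "\<exists>t>0. t *\<^sub>R x \<in> U" for x by (rule linear_topology_absorbing[OF T U])
  obtain r where r: "\<And>f x. f \<in> polar U \<Longrightarrow> \<bar>f x\<bar> \<le> r x"
    using polar_bounded[OF absorb] by metis
  \<comment> \<open>For linear \<open>b i\<close>, the linear members of \<open>E n\<close> are the
    span of the first \<open>n\<close> of them; stating this by vanishing on the common kernel makes
    closedness under pointwise limits immediate.\<close>
  define E where "E n = (\<Inter>x\<in>{x. \<forall>i<n. b i x = 0}. {f :: 'a \<Rightarrow> real. f x = 0})" for n :: nat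
  have mono: "E m \<subseteq> E n" if "m \<le> n" for m n using that by (auto simp: E_def)
  have closed: "closed (E n)" for n
    unfolding E_def by (intro closed_INT ballI closed_Collect_eq continuous_intros) auto
  have "subspace (\<Union>n. E n)"
    unfolding subspace_def
  proof (intro conjI ballI allI)
    show "0 \<in> (\<Union>n. E n)" by (auto simp: E_def)
  next
    fix f g assume "f \<in> (\<Union>n. E n)" "g \<in> (\<Union>n. E n)"
    then obtain m n where "f \<in> E m" "g \<in> E n" by blast
    then have "f \<in> E (max m n)" "g \<in> E (max m n)"
      using mono[of m "max m n"] mono[of n "max m n"] by auto
    then have "f + g \<in> E (max m n)" by (simp add: E_def)
    then show "f + g \<in> (\<Union>n. E n)" by blast
  next
    fix c f assume "f \<in> (\<Union>n. E n)"
    then obtain n where "f \<in> E n" by blast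
    then have "c *\<^sub>R f \<in> E n" by (simp add: E_def scaleR_fun_def)
    then show "c *\<^sub>R f \<in> (\<Union>n. E n)" by blast
  qed
  moreover have "range b \<subseteq> (\<Union>n. E n)"
  proof safe
    fix i have "b i \<in> E (Suc i)" by (simp add: E_def)
    then show "b i \<in> (\<Union>n. E n)" by blast
  qed
  ultimately have "span (range b) \<subseteq> (\<Union>n. E n)" by (simp add: span_minimal)
  then have cover: "polar U \<subseteq> (\<Union>n. E n)"
    using b polar_subset_dual_space[OF T U] by blast
  obtain n g t where g: "g \<in> polar U \<inter> E n" "0 < t"
      "\<And>f. f \<in> polar U \<Longrightarrow> (1 - t) *\<^sub>R g + t *\<^sub>R f \<in> E n"
  proof (rule compact_convex_Baire)
    show "compact (polar U)" by (rule compact_polar[OF absorb])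
    show "polar U \<noteq> {}" using zero_in_polar by blast
  qed (use r convex_polar closed cover in auto)
  show thesis
  proof (rule that)
    fix f x assume f: "f \<in> polar U" and x: "\<And>i. i < n \<Longrightarrow> b i x = 0"
    have "(1 - t) * g x + t * f x = 0" "g x = 0"
      using g(1) g(3)[OF f] x by (auto simp: E_def scaleR_fun_def)
    then show "f x = 0" using g(2) by simp
  qed
qed

text \<open>With a finite-rank map \<open>P\<close> whose remainders lie in the kernel of
  \<open>b 0, ..., b (n - 1)\<close>, each \<open>x\<close> is the midpoint of
  \<open>2 *\<^sub>R (x - P x)\<close> and \<open>2 *\<^sub>R P x\<close>. The first is in the
  convex set \<open>V\<close> because that kernel is, the second for \<open>x\<close> weakly near 0
  because \<open>P\<close> is continuous from the weak to the original topology.\<close>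

lemma countable_dual_imp_weak_neighbourhood:
  fixes T :: "'a::real_vector topology"
  assumes T: "linear_topology T" "neighbourhood_base_of convex T"
    and B: "countable B" "hamel_basis (dual_space T) B" and W: "openin T W" "0 \<in> W"
  obtains N where "openin (weak_topology T) N" "0 \<in> N" "N \<subseteq> W"
proof -
  have top: "topspace T = UNIV" using T(1) by (simp add: linear_topology_def)
  \<comment> \<open>Inserting 0 allows for an empty basis and does not change the span.\<close>
  define b where "b = from_nat_into (insert 0 B)"
  have b: "range b = insert 0 B"
    unfolding b_def by (rule range_from_nat_into) (use B(1) in auto)
  have span_b: "span (range b) = dual_space T"
    using B(2) by (simp add: b hamel_basis_def span_insert_0)
  have b_dual: "b i \<in> dual_space T" for i using span_b span_base[of "b i" "range b"] by auto
  obtain U V where UV: "openin T U" "convex V" "0 \<in> U" "U \<subseteq> V" "V \<subseteq> W"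
    using T(2) W unfolding neighbourhood_base_of by metis
  \<comment> \<open>Symmetrising turns the one-sided Hahn--Banach bound on \<open>V\<close> into
    \<open>\<bar>f x\<bar> \<le> 1\<close> on \<open>A\<close>.\<close>
  define A where "A = U \<inter> {x. - x \<in> U}"
  have "continuous_map T T (\<lambda>x. (-1) *\<^sub>R x)"
    using top by (intro linear_topology_continuous_scaleR[OF T(1)]) auto
  from openin_continuous_map_preimage[OF this UV(1)] have A: "openin T A"
    using UV(1) top by (simp add: A_def openin_Int)
  have "0 \<in> A" using UV(3) by (simp add: A_def)
  then obtain n where n: "\<And>f x. f \<in> polar A \<Longrightarrow> (\<And>i. i < n \<Longrightarrow> b i x = 0) \<Longrightarrow> f x = 0"
    using countable_dual_polar_finite[OF T(1) A, of b] span_b by (metis order_refl)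
  \<comment> \<open>A functional separating \<open>y\<close> from \<open>V\<close> lies in
    \<open>polar A\<close> and so vanishes at \<open>y\<close>, against
    \<open>1 \<le> f y\<close>.\<close>
  have kernel: "y \<in> V" if y: "\<And>i. i < n \<Longrightarrow> b i y = 0" for y
  proof (rule ccontr)
    assume "y \<notin> V"
    moreover have "\<exists>t>0. t *\<^sub>R x \<in> V" for x
      using linear_topology_absorbing[OF T(1) UV(1,3), of x] UV(4) by blast
    ultimately obtain f :: "'a \<Rightarrow> real" where f: "linear f" "\<And>x. x \<in> V \<Longrightarrow> f x \<le> 1" "1 \<le> f y"
      using convex_absorbing_Hahn_Banach[OF UV(2)] by metis
    have "\<bar>f x\<bar> \<le> 1" if "x \<in> U" "- x \<in> U" for x
      using f(2)[of x] f(2)[of "- x"] that UV(4) linear_neg[OF f(1), of x] by (auto simp: abs_le_iff)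
    then have "f \<in> polar A" using f(1) by (simp add: polar_def A_def)
    from n[OF this y] f(3) show False by simp
  qed
  define G where "G = b ` {..<n}"
  have G: "finite G" "\<And>f. f \<in> G \<Longrightarrow> linear f"
    using b_dual by (auto simp: G_def dual_space_def)
  obtain m :: nat and e \<phi> where \<phi>: "\<And>i. i < m \<Longrightarrow> \<phi> i \<in> span G"
    "\<And>f x. f \<in> G \<Longrightarrow> f (x - (\<Sum>i<m. \<phi> i x *\<^sub>R e i)) = 0"
    using finite_functionals_decomposition[OF G] by metis
  have "span G \<subseteq> dual_space T"
    using span_mono[of G "range b"] span_b by (auto simp: G_def)
  then have \<phi>_dual: "\<phi> i \<in> dual_space T" if "i < m" for i
    using \<phi>(1)[OF that] by blast
  \<comment> \<open>The factor 2 anticipates the midpoint at the end.\<close>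
  define s where "s x = 2 *\<^sub>R (\<Sum>i<m. \<phi> i x *\<^sub>R e i)" for x
  have cont: "continuous_map (weak_topology T) T s"
    unfolding s_def
    by (intro linear_topology_continuous_scaleR[OF T(1)] linear_topology_continuous_sum[OF T(1)])
      (use \<phi>_dual top in \<open>auto intro: weak_topology_continuous_functional\<close>)
  show thesis
  proof (rule that)
    show "openin (weak_topology T) {x. s x \<in> U}"
      using openin_continuous_map_preimage[OF cont UV(1)] by simp
    have "\<phi> i 0 = 0" if "i < m" for i using \<phi>_dual[OF that] by (simp add: dual_space_def linear_0)
    then show "0 \<in> {x. s x \<in> U}" using UV(3) by (simp add: s_def)
    show "{x. s x \<in> U} \<subseteq> W"
    proof
      fix x assume "x \<in> {x. s x \<in> U}"
      then have sx: "s x \<in> V" using UV(4) by blast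
      define y where "y = x - (\<Sum>i<m. \<phi> i x *\<^sub>R e i)"
      have "b i (2 *\<^sub>R y) = 0" if "i < n" for i
        using \<phi>(2)[of "b i" x] that linear_cmul[OF G(2), of "b i" 2 y] by (simp add: y_def G_def)
      then have "2 *\<^sub>R y \<in> V" by (rule kernel)
      then have "(1/2) *\<^sub>R (2 *\<^sub>R y) + (1/2) *\<^sub>R s x \<in> V"
        by (intro convexD[OF UV(2) _ sx]) auto
      then show "x \<in> W" using UV(5) by (auto simp: y_def s_def)
    qed
  qed
qed

lemma countable_dual_imp_weak_eq:
  fixes T :: "'a::real_vector topology"
  assumes T: "linear_topology T" "neighbourhood_base_of convex T"
    and B: "countable B" "hamel_basis (dual_space T) B"
  shows "weak_topology T = T"
proof (rule topology_eq[THEN iffD2], intro allI iffI)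
  have top: "topspace T = UNIV" using T(1) by (simp add: linear_topology_def)
  show "openin T W" if "openin (weak_topology T) W" for W
    using weak_topology_coarsest[OF top, of T] that by (auto simp: dual_space_def)
  show "openin (weak_topology T) W" if W: "openin T W" for W
  proof (subst openin_subopen, safe)
    fix x assume x: "x \<in> W"
    have "continuous_map T T (\<lambda>y. x + y)"
      using top by (intro linear_topology_continuous_add[OF T(1)]) auto
    from openin_continuous_map_preimage[OF this W] have "openin T {y. x + y \<in> W}"
      using top by simp
    then obtain N where N: "openin (weak_topology T) N" "0 \<in> N" "N \<subseteq> {y. x + y \<in> W}"
      using countable_dual_imp_weak_neighbourhood[OF T B] x by (metis (mono_tags) add.right_neutral mem_Collect_eq)
    \<comment> \<open>Weak translations are continuous because functionals are additive, so it
      suffices to compare neighbourhoods of 0.\<close>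
    have "continuous_map (weak_topology T) (weak_topology T) (\<lambda>y. y - x)"
    proof (rule continuous_map_into_weak_topology)
      fix f assume f: "f \<in> dual_space T"
      then have "(\<lambda>y. f (y - x)) = (\<lambda>y. f y - f x)" by (auto simp: dual_space_def linear_diff)
      then show "continuous_map (weak_topology T) euclideanreal (\<lambda>y. f (y - x))"
        using weak_topology_continuous_functional[OF f] by (auto intro: continuous_map_diff)
    qed
    from openin_continuous_map_preimage[OF this N(1)]
    have "openin (weak_topology T) {y. y - x \<in> N}" by simp
    moreover have "{y. y - x \<in> N} \<subseteq> W" using N(3) by force
    ultimately show "\<exists>N. openin (weak_topology T) N \<and> x \<in> N \<and> N \<subseteq> W"
      using N(2) by (intro exI[of _ "{y. y - x \<in> N}"]) auto
  qed
qed

theorem theorem1p13: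
  fixes T :: "'a::real_vector topology"
  assumes "locally_convex_linear_metric T"
  shows "(metrizable_space (weak_topology T) \<longleftrightarrow> Ascoli_space (weak_topology T)) \<and>
    (Ascoli_space (weak_topology T) \<longleftrightarrow> \<not> (\<exists>F. strong_Fin_fan (weak_topology T) F)) \<and>
    (\<not> (\<exists>F. strong_Fin_fan (weak_topology T) F) \<longleftrightarrow> weak_topology T = T) \<and>
    (weak_topology T = T \<longleftrightarrow> (\<exists>B. countable B \<and> hamel_basis (dual_space T) B))"
proof -
  have T: "linear_topology T" "neighbourhood_base_of convex T" "metrizable_space T"
    using assms by (auto simp: locally_convex_linear_metric_def)
  have "weak_topology T = T \<Longrightarrow> metrizable_space (weak_topology T)"
    using T(3) by simp
  moreover note metrizable_imp_Ascoli_space[of "weak_topology T"]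
    Ascoli_space_imp_no_strong_Fin_fan[of "weak_topology T"]
    no_strong_Fin_fan_imp_countable_dual[OF T(1) metrizable_imp_first_countable[OF T(3)]]
    countable_dual_imp_weak_eq[OF T(1,2)]
  ultimately show ?thesis by blast
qed

end
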